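(* Let $K$ be a field, $S=K[x_1,\ldots,x_n]$, $T=K[x_1,\ldots,x_{n-1}]$, and let $\varphi\colon S\to T$ be the $K$-algebra homomorphism with $x_i\mapsto x_i$ for $i=1,\ldots,n-1$ and $x_n\mapsto 1$. Let $I\subset S$ be a pretty clean monomial ideal. Then $$\operatorname{fdepth} T/\varphi(I)\ \ge\ \operatorname{fdepth} S/I-1.$$
   Context: The following definitions are given for $S$ and apply equally to $T$. A monomial prime ideal is a prime ideal generated by a (possibly empty) subset of the variables. For a monomial ideal $I\subset S$, a prime filtration of $S/I$ is a chain of monomial ideals $\mathcal F: I=I_0\subset I_1\subset\cdots\subset I_r=S$ such that for each $j=1,\ldots,r$ there is an isomorphism of $\mathbb Z^n$-graded $S$-modules $I_j/I_{j-1}\cong(S/P_j)(-a_j)$ with $P_j$ a monomial prime ideal and $a_j\in\mathbb Z^n$. The filtration is pretty clean if for all $i<j$ the inclusion $P_i\subset P_j$ implies $P_i=P_j$; the ideal $I$ is pretty clean if $S/I$ has a pretty clean filtration. One sets $\operatorname{fdepth}\mathcal F=\min\{\dim S/P_1,\ldots,\dim S/P_r\}$ and $\operatorname{fdepth} S/I=\max\{\operatorname{fdepth}\mathcal F : \mathcal F\text{ is a prime filtration of } S/I\}$. *)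

theory Defs
  imports
    "HOL-Algebra.QuotRing"
    "HOL-Algebra.Module"
    "HOL-Library.Poly_Mapping"
    "HOL-Library.Extended_Nat"
begin

section \<open>Polynomial rings\<close>

text \<open>
  The type below is the polynomial ring over \<open>'k\<close> in the variables \<open>x\<^sub>i\<close>, \<open>i :: nat\<close>: an
  exponent vector is a finitely supported function \<open>nat \<Rightarrow>\<^sub>0 nat\<close>, and a polynomial assigns
  finitely many exponent vectors a nonzero coefficient. The ring \<open>K[x\<^sub>1,\<dots>,x\<^sub>n]\<close> is carved out as
  a carrier, because the number of variables has to vary within one statement.
\<close>

type_synonym 'k mpoly = "(nat \<Rightarrow>\<^sub>0 nat) \<Rightarrow>\<^sub>0 'k"

definition exponents :: "nat \<Rightarrow> (nat \<Rightarrow>\<^sub>0 nat) set"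
  where "exponents n = {m. Poly_Mapping.keys m \<subseteq> {1..n}}"

definition poly_ring :: "nat \<Rightarrow> ('k::field) mpoly ring"
  where "poly_ring n =
    \<lparr>carrier = {p. Poly_Mapping.keys p \<subseteq> exponents n}, mult = (*), one = 1, zero = 0, add = (+)\<rparr>"

definition const :: "'k::field \<Rightarrow> 'k mpoly"
  where "const c = Poly_Mapping.single 0 c"

definition monomial :: "(nat \<Rightarrow>\<^sub>0 nat) \<Rightarrow> ('k::field) mpoly"
  where "monomial m = Poly_Mapping.single m 1"

definition X :: "nat \<Rightarrow> ('k::field) mpoly"
  where "X i = monomial (Poly_Mapping.single i 1)"

definition algebra_hom :: "nat \<Rightarrow> nat \<Rightarrow> (('k::field) mpoly \<Rightarrow> 'k mpoly) set"
  where "algebra_hom n m =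
    {h \<in> ring_hom (poly_ring n) (poly_ring m). \<forall>c. h (const c) = const c}"

definition monomial_ideal :: "nat \<Rightarrow> ('k::field) mpoly set \<Rightarrow> bool"
  where "monomial_ideal n I \<longleftrightarrow>
    (\<exists>G \<subseteq> exponents n. I = Idl\<^bsub>poly_ring n\<^esub> (monomial ` G))"

definition monomial_prime :: "nat \<Rightarrow> ('k::field) mpoly set \<Rightarrow> bool"
  where "monomial_prime n P \<longleftrightarrow>
    primeideal P (poly_ring n) \<and> (\<exists>A \<subseteq> {1..n}. P = Idl\<^bsub>poly_ring n\<^esub> (X ` A))"


section \<open>Krull dimension\<close>

definition krull_dim :: "('a, 'b) ring_scheme \<Rightarrow> enat"
  where "krull_dim R = Sup {enat k | k. \<exists>p :: nat \<Rightarrow> 'a set.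
    (\<forall>i\<le>k. primeideal (p i) R) \<and> (\<forall>i<k. p i \<subset> p (Suc i))}"


section \<open>Multigraded modules\<close>

text \<open>
  Degrees are finitely supported integer vectors. The group \<open>\<int>\<^sup>n\<close> consists of those supported
  on \<open>{1..n}\<close>; the modules considered here are zero in all other degrees.
\<close>

type_synonym mdegree = "nat \<Rightarrow>\<^sub>0 int"

definition mdegrees :: "nat \<Rightarrow> mdegree set"
  where "mdegrees n = {a. Poly_Mapping.keys a \<subseteq> {1..n}}"

record ('a, 'b) graded_module = "('a, 'b) module" +
  component :: "mdegree \<Rightarrow> 'b set"

definition poly_component :: "nat \<Rightarrow> mdegree \<Rightarrow> ('k::field) mpoly set"
  where "poly_component n b =
    {p \<in> carrier (poly_ring n). \<forall>m \<in> Poly_Mapping.keys p. Poly_Mapping.map int m = b}"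

text \<open>
  The graded module \<open>I/J\<close> for monomial ideals \<open>J \<subseteq> I\<close> of \<open>K[x\<^sub>1,\<dots>,x\<^sub>n]\<close>. The record fields
  \<open>mult\<close> and \<open>one\<close> are inherited from rings and are meaningless for a module. The union in
  \<open>smult\<close> is the coset of \<open>r \<cdot> x\<close>, for any representative \<open>x\<close> of \<open>A\<close>.
\<close>

definition quot_module ::
    "nat \<Rightarrow> ('k::field) mpoly set \<Rightarrow> 'k mpoly set \<Rightarrow> ('k mpoly, 'k mpoly set) graded_module"
  where "quot_module n I J =
    \<lparr>carrier = {J +>\<^bsub>poly_ring n\<^esub> x | x. x \<in> I},
     mult = undefined, one = undefined,
     zero = J, add = set_add (poly_ring n),
     smult = (\<lambda>r A. \<Union>x\<in>A. J +>\<^bsub>poly_ring n\<^esub> (r \<otimes>\<^bsub>poly_ring n\<^esub> x)),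
     component = (\<lambda>b. {J +>\<^bsub>poly_ring n\<^esub> x | x. x \<in> I \<inter> poly_component n b})\<rparr>"

text \<open>The shifted module \<open>M(a)\<close>, with \<open>M(a)\<^sub>b = M\<^bsub>a+b\<^esub>\<close>.\<close>

definition shift :: "('a, 'b) graded_module \<Rightarrow> mdegree \<Rightarrow> ('a, 'b) graded_module"
  where "shift M a = M\<lparr>component := (\<lambda>b. component M (a + b))\<rparr>"

definition graded_isomorphic ::
    "('a, 'c) ring_scheme \<Rightarrow> ('a, 'b) graded_module \<Rightarrow> ('a, 'd) graded_module \<Rightarrow> bool"
  where "graded_isomorphic R M N \<longleftrightarrow> (\<exists>f.
    bij_betw f (carrier M) (carrier N) \<and>
    (\<forall>x \<in> carrier M. \<forall>y \<in> carrier M. f (x \<oplus>\<^bsub>M\<^esub> y) = f x \<oplus>\<^bsub>N\<^esub> f y) \<and>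
    (\<forall>r \<in> carrier R. \<forall>x \<in> carrier M. f (r \<odot>\<^bsub>M\<^esub> x) = r \<odot>\<^bsub>N\<^esub> f x) \<and>
    (\<forall>b. f ` component M b = component N b))"


section \<open>Prime filtrations\<close>

text \<open>
  The filtration is the chain \<open>F 0, \<dots>, F r\<close>; values of \<open>F\<close> and \<open>P\<close> at other indices are
  irrelevant. The primes \<open>P 1, \<dots>, P r\<close> are determined by the chain, as \<open>P j\<close> is the
  annihilator of \<open>F j / F (j - 1)\<close>.
\<close>

definition prime_filtration ::
    "nat \<Rightarrow> ('k::field) mpoly set \<Rightarrow> nat \<Rightarrow> (nat \<Rightarrow> 'k mpoly set) \<Rightarrow> (nat \<Rightarrow> 'k mpoly set) \<Rightarrow> bool"
  where "prime_filtration n I r F P \<longleftrightarrow>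
    F 0 = I \<and> F r = carrier (poly_ring n) \<and>
    (\<forall>j\<le>r. monomial_ideal n (F j)) \<and>
    (\<forall>j \<in> {1..r}. F (j - 1) \<subset> F j \<and> monomial_prime n (P j) \<and>
      (\<exists>a \<in> mdegrees n.
        graded_isomorphic (poly_ring n) (quot_module n (F j) (F (j - 1)))
          (shift (quot_module n (carrier (poly_ring n)) (P j)) (- a))))"

definition pretty_clean :: "nat \<Rightarrow> ('k::field) mpoly set \<Rightarrow> bool"
  where "pretty_clean n I \<longleftrightarrow> (\<exists>r F P. prime_filtration n I r F P \<and>
    (\<forall>i \<in> {1..r}. \<forall>j \<in> {1..r}. i < j \<longrightarrow> P i \<subseteq> P j \<longrightarrow> P i = P j))"

text \<open>
  The minimum and the maximum are taken as infimum and supremum in the extended naturals. The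
  only filtration of the zero module is the empty one, so the zero module has \<open>fdepth\<close> \<open>\<infinity>\<close>.
\<close>

definition fdepth_filtration :: "nat \<Rightarrow> nat \<Rightarrow> (nat \<Rightarrow> ('k::field) mpoly set) \<Rightarrow> enat"
  where "fdepth_filtration n r P = (INF j \<in> {1..r}. krull_dim (poly_ring n Quot P j))"

definition fdepth :: "nat \<Rightarrow> ('k::field) mpoly set \<Rightarrow> enat"
  where "fdepth n I = Sup {fdepth_filtration n r P | r F P. prime_filtration n I r F P}"

end

(*
  A monomial ideal is the span of an up-closed set of exponents. A prime filtration step J < I with I/J = (S/P)(-a) means that I = J + (u) and J : u = P for a monomial u.
  Setting x_n = 1 amounts to deleting the n-th coordinate of the exponents, and it commutes with
  colons: if x_n lies in P the two ideals become equal, otherwise they again form a step, with the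
  prime generated by the same variables. As S/P is a polynomial ring in the variables outside P,
  the dimension drops by exactly one in the second case, so that every filtration of S/I yields one
  of T/phi(I) whose fdepth is smaller by at most one.
*)

theory Submission
  imports Defs
begin

section \<open>Monomial subspaces\<close>

text \<open>Modules enter only through the equivalence of a graded isomorphism with a
  \<open>prime_step\<close>; beyond it a filtration is a chain of exponent sets labelled by sets of
  variables. Since \<open>fdepth_filtration\<close> sees only the labels, discarding the steps that
  become trivial can only raise the minimum.

  The real obstacle is the dimension of \<open>S/P\<close>, because \<open>krull_dim\<close> is a
  supremum over chains of arbitrary primes. The lower bound comes from chains of variable ideals.
  For the upper bound, a chain of length \<open>l\<close> over \<open>d\<close> free variables
  provides elements \<open>y_i\<close> that lie in prime number \<open>i + 1\<close> but not in
  prime number \<open>i\<close>. Their power products are linearly independent. Those with all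
  exponents at most \<open>N\<close> are therefore \<open>(N + 1)^l\<close> independent polynomials,
  yet they lie in the span of at most \<open>(c N + 1)^d\<close> monomials for a constant
  \<open>c\<close>. A suitable \<open>N\<close> then rules out \<open>l > d\<close>.\<close>

lemma poly_mapping_expand: "p = (\<Sum>a\<in>Poly_Mapping.keys p. Poly_Mapping.single a (Poly_Mapping.lookup p a))"
  by (rule poly_mapping_eqI)
    (auto simp: lookup_sum lookup_single when_def in_keys_iff sum.delta' if_distrib cong: if_cong)

text \<open>Reduction modulo a monomial subspace: \<open>r\<close> lies in the span of
  \<open>E\<close>, and \<open>q\<close> represents \<open>p\<close> without exponents from
  \<open>E\<close>. Both the primality of variable ideals and the choice of representatives in the
  upper dimension bound rest on it.\<close>

lemma poly_mapping_split:
  fixes p :: "'a \<Rightarrow>\<^sub>0 'b::comm_monoid_add"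
  obtains q r where "p = q + r" "Poly_Mapping.keys q \<subseteq> Poly_Mapping.keys p - E"
    "Poly_Mapping.keys r \<subseteq> Poly_Mapping.keys p \<inter> E"
proof
  let ?f = "\<lambda>a. Poly_Mapping.single a (Poly_Mapping.lookup p a)"
  show "p = sum ?f (Poly_Mapping.keys p - E) + sum ?f (Poly_Mapping.keys p \<inter> E)"
    using poly_mapping_expand[of p] sum.Int_Diff[of "Poly_Mapping.keys p" ?f E]
    by (simp add: add.commute)
  show "Poly_Mapping.keys (sum ?f (Poly_Mapping.keys p - E)) \<subseteq> Poly_Mapping.keys p - E"
    by (rule order.trans[OF keys_sum]) auto
  show "Poly_Mapping.keys (sum ?f (Poly_Mapping.keys p \<inter> E)) \<subseteq> Poly_Mapping.keys p \<inter> E"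
    by (rule order.trans[OF keys_sum]) auto
qed

lemma lookup_single_mult_add:
  fixes p :: "'a::cancel_comm_monoid_add \<Rightarrow>\<^sub>0 'b::comm_semiring_0"
  shows "Poly_Mapping.lookup (Poly_Mapping.single m c * p) (m + v) = c * Poly_Mapping.lookup p v"
proof -
  have "Poly_Mapping.single m c * p
      = (\<Sum>a\<in>Poly_Mapping.keys p. Poly_Mapping.single (m + a) (c * Poly_Mapping.lookup p a))"
    by (subst (1) poly_mapping_expand[of p]) (simp add: sum_distrib_left mult_single)
  then show ?thesis
    by (auto simp: lookup_sum lookup_single when_def in_keys_iff if_distrib sum.delta' cong: if_cong)
qed

text \<open>Translation by \<open>m\<close> is injective and a product of nonzero coefficients is
  nonzero, so no term is lost and the supports agree exactly.\<close>

lemma keys_single_mult: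
  fixes p :: "'a::cancel_comm_monoid_add \<Rightarrow>\<^sub>0 'b::idom"
  assumes "c \<noteq> 0"
  shows "Poly_Mapping.keys (Poly_Mapping.single m c * p) = (+) m ` Poly_Mapping.keys p"
proof
  show "Poly_Mapping.keys (Poly_Mapping.single m c * p) \<subseteq> (+) m ` Poly_Mapping.keys p"
    using keys_mult[of "Poly_Mapping.single m c" p] by (auto split: if_splits)
  show "(+) m ` Poly_Mapping.keys p \<subseteq> Poly_Mapping.keys (Poly_Mapping.single m c * p)"
    using assms by (auto simp: in_keys_iff lookup_single_mult_add)
qed

lemma keys_plus_nat:
  fixes a b :: "'a \<Rightarrow>\<^sub>0 nat"
  shows "Poly_Mapping.keys (a + b) = Poly_Mapping.keys a \<union> Poly_Mapping.keys b"
  by (auto simp: in_keys_iff lookup_add)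

lemma exponents_add_iff [simp]: "a + b \<in> exponents n \<longleftrightarrow> a \<in> exponents n \<and> b \<in> exponents n"
  by (simp add: exponents_def keys_plus_nat)

lemma zero_in_exponents [simp]: "0 \<in> exponents n"
  by (simp add: exponents_def)

lemma poly_ring_simps [simp]:
  "carrier (poly_ring n) = {p. Poly_Mapping.keys p \<subseteq> exponents n}"
  "mult (poly_ring n) = (*)" "one (poly_ring n) = 1" "zero (poly_ring n) = 0"
  "add (poly_ring n) = (+)"
  by (simp_all add: poly_ring_def)

lemma keys_mult_exponents:
  assumes "Poly_Mapping.keys p \<subseteq> exponents n" "Poly_Mapping.keys q \<subseteq> exponents n"
  shows "Poly_Mapping.keys (p * q) \<subseteq> exponents n"
  using keys_mult[of p q] assms by fastforce

lemma keys_add_subset: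
  assumes "Poly_Mapping.keys p \<subseteq> E" "Poly_Mapping.keys q \<subseteq> E"
  shows "Poly_Mapping.keys (p + q) \<subseteq> E"
  using keys_add[of p q] assms by blast

lemma keys_uminus:
  fixes p :: "'a \<Rightarrow>\<^sub>0 'b::ab_group_add"
  shows "Poly_Mapping.keys (- p) = Poly_Mapping.keys p"
  by (auto simp: in_keys_iff)

lemma keys_diff_subset:
  fixes p q :: "'a \<Rightarrow>\<^sub>0 'b::ab_group_add"
  assumes "Poly_Mapping.keys p \<subseteq> E" "Poly_Mapping.keys q \<subseteq> E"
  shows "Poly_Mapping.keys (p - q) \<subseteq> E"
  using keys_add_subset[of p E "- q"] assms by (simp add: keys_uminus)

lemma cring_poly_ring: "cring (poly_ring n :: ('k::field) mpoly ring)"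
proof (rule cringI)
  show "abelian_group (poly_ring n :: 'k mpoly ring)"
  proof (rule abelian_groupI)
    fix x :: "'k mpoly" assume "x \<in> carrier (poly_ring n)"
    then show "\<exists>y\<in>carrier (poly_ring n). y \<oplus>\<^bsub>poly_ring n\<^esub> x = \<zero>\<^bsub>poly_ring n\<^esub>"
      by (intro bexI[of _ "- x"]) (auto simp: keys_uminus)
  qed (auto simp: algebra_simps dest: keys_add_subset intro: keys_add_subset[THEN subsetD])
  show "comm_monoid (poly_ring n :: 'k mpoly ring)"
    by (rule comm_monoidI)
      (auto simp: algebra_simps dest: keys_mult_exponents[THEN subsetD, rotated -1])
qed (auto simp: algebra_simps)

lemma minus_poly_ring:
  assumes "x \<in> carrier (poly_ring n)"
  shows "\<ominus>\<^bsub>poly_ring n\<^esub> x = - x"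
proof -
  interpret cring "poly_ring n" by (rule cring_poly_ring)
  show ?thesis
    using assms by (intro minus_equality) (auto simp: keys_uminus)
qed

section \<open>Monomial ideals as up-closed exponent sets\<close>

definition mono_span :: "(nat \<Rightarrow>\<^sub>0 nat) set \<Rightarrow> ('k::field) mpoly set"
  where "mono_span E = {p. Poly_Mapping.keys p \<subseteq> E}"

definition upset :: "nat \<Rightarrow> (nat \<Rightarrow>\<^sub>0 nat) set \<Rightarrow> bool"
  where "upset n E \<longleftrightarrow> E \<subseteq> exponents n \<and> (\<forall>e\<in>E. \<forall>v\<in>exponents n. e + v \<in> E)"

lemma mono_span_iff: "p \<in> mono_span E \<longleftrightarrow> Poly_Mapping.keys p \<subseteq> E"
  by (simp add: mono_span_def)

lemma single_in_mono_span: "c \<noteq> 0 \<Longrightarrow> Poly_Mapping.single m c \<in> mono_span E \<longleftrightarrow> m \<in> E"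
  by (simp add: mono_span_iff)

lemma mono_span_subset_iff: "mono_span E \<subseteq> (mono_span F :: ('k::field) mpoly set) \<longleftrightarrow> E \<subseteq> F"
proof
  assume sub: "mono_span E \<subseteq> (mono_span F :: 'k mpoly set)"
  show "E \<subseteq> F"
  proof
    fix e assume "e \<in> E"
    then have "Poly_Mapping.single e 1 \<in> (mono_span E :: 'k mpoly set)" by (simp add: mono_span_iff)
    with sub have "Poly_Mapping.single e 1 \<in> (mono_span F :: 'k mpoly set)" by blast
    then show "e \<in> F" by (simp add: mono_span_iff)
  qed
qed (auto simp: mono_span_iff)

lemma mono_span_eq_iff: "mono_span E = (mono_span F :: ('k::field) mpoly set) \<longleftrightarrow> E = F"
  using mono_span_subset_iff[of E F] mono_span_subset_iff[of F E] by (metis subset_antisym order_refl)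

lemma carrier_eq_mono_span: "carrier (poly_ring n) = mono_span (exponents n)"
  by (simp add: mono_span_def)

lemma upset_exponents: "upset n (exponents n)"
  by (simp add: upset_def)

lemma ideal_mono_span:
  assumes "upset n E"
  shows "ideal (mono_span E :: ('k::field) mpoly set) (poly_ring n)"
proof -
  interpret cring "poly_ring n :: 'k mpoly ring" by (rule cring_poly_ring)
  have E: "E \<subseteq> exponents n" using assms by (simp add: upset_def)
  have mult: "x * a \<in> mono_span E"
    if "a \<in> mono_span E" "x \<in> carrier (poly_ring n)" for a x :: "'k mpoly"
  proof -
    have "u + v \<in> E" if "u \<in> Poly_Mapping.keys x" "v \<in> Poly_Mapping.keys a" for u v
    proof -
      have "v \<in> E" "u \<in> exponents n"
        using that \<open>a \<in> _\<close> \<open>x \<in> _\<close> by (auto simp: mono_span_iff)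
      then show ?thesis using assms by (subst add.commute) (auto simp: upset_def)
    qed
    then show ?thesis using keys_mult[of x a] by (auto simp: mono_span_iff)
  qed
  show ?thesis
  proof (rule idealI)
    show "subgroup (mono_span E :: 'k mpoly set) (add_monoid (poly_ring n))"
    proof (rule add.subgroupI)
      show "\<ominus>\<^bsub>poly_ring n\<^esub> a \<in> mono_span E" if "a \<in> mono_span E" for a :: "'k mpoly"
        using minus_poly_ring[of a n] that E
        by (auto simp: mono_span_iff keys_uminus)
      show "a \<oplus>\<^bsub>poly_ring n\<^esub> b \<in> mono_span E"
        if "a \<in> mono_span E" "b \<in> mono_span E" for a b :: "'k mpoly"
        using that by (simp add: mono_span_iff keys_add_subset)
      show "(mono_span E :: 'k mpoly set) \<noteq> {}"
      proof -
        have "0 \<in> (mono_span E :: 'k mpoly set)" by (simp add: mono_span_iff)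
        then show ?thesis by blast
      qed
    qed (use E in \<open>simp add: mono_span_def Collect_mono order.trans\<close>)
  qed (use mult ring_axioms in \<open>auto simp: mult.commute\<close>)
qed

lemma upset_generated:
  assumes "G \<subseteq> exponents n"
  shows "upset n {g + v |g v. g \<in> G \<and> v \<in> exponents n}"
  unfolding upset_def
proof (intro conjI ballI)
  show "{g + v |g v. g \<in> G \<and> v \<in> exponents n} \<subseteq> exponents n"
    using assms by auto
next
  fix e w assume "e \<in> {g + v |g v. g \<in> G \<and> v \<in> exponents n}" and w: "w \<in> exponents n"
  then obtain g v where "e = g + v" "g \<in> G" "v \<in> exponents n" by blast
  then have "e + w = g + (v + w)" "g \<in> G" "v + w \<in> exponents n"
    using w by (simp_all add: add.assoc)
  then show "e + w \<in> {g + v |g v. g \<in> G \<and> v \<in> exponents n}" by blast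
qed

text \<open>The span of the multiples of the generators is already an ideal, which gives one
  inclusion. Conversely, each single term with such an exponent is a generator times a term, and a
  polynomial is the finite sum of its terms.\<close>

lemma genideal_monomials:
  assumes "G \<subseteq> exponents n"
  shows "Idl\<^bsub>poly_ring n\<^esub> (monomial ` G) = (mono_span {g + v |g v. g \<in> G \<and> v \<in> exponents n} :: ('k::field) mpoly set)"
    (is "_ = mono_span ?E")
proof -
  interpret cring "poly_ring n :: 'k mpoly ring" by (rule cring_poly_ring)
  have up: "upset n ?E" by (rule upset_generated[OF assms])
  show ?thesis
  proof
    show "Idl\<^bsub>poly_ring n\<^esub> (monomial ` G) \<subseteq> (mono_span ?E :: 'k mpoly set)"
    proof (rule genideal_minimal[OF ideal_mono_span[OF up]])
      show "monomial ` G \<subseteq> (mono_span ?E :: 'k mpoly set)"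
      proof
        fix x :: "'k mpoly" assume "x \<in> monomial ` G"
        then obtain g where g: "x = monomial g" "g \<in> G" by blast
        have "g + 0 \<in> ?E" using g(2) zero_in_exponents by blast
        then show "x \<in> mono_span ?E" by (simp add: g(1) monomial_def mono_span_iff)
      qed
    qed
    have carr: "monomial ` G \<subseteq> carrier (poly_ring n :: 'k mpoly ring)"
      using assms by (auto simp: monomial_def)
    interpret I: ideal "Idl\<^bsub>poly_ring n\<^esub> (monomial ` G) :: 'k mpoly set" "poly_ring n"
      by (rule genideal_ideal[OF carr])
    show "(mono_span ?E :: 'k mpoly set) \<subseteq> Idl\<^bsub>poly_ring n\<^esub> (monomial ` G)"
    proof
      fix p :: "'k mpoly" assume p: "p \<in> mono_span ?E"
      have single: "Poly_Mapping.single e c \<in> Idl\<^bsub>poly_ring n\<^esub> (monomial ` G)"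
        if "e \<in> ?E" for e and c :: 'k
      proof -
        obtain g v where gv: "e = g + v" "g \<in> G" "v \<in> exponents n" using \<open>e \<in> ?E\<close> by blast
        have "monomial g \<in> Idl\<^bsub>poly_ring n\<^esub> (monomial ` G :: 'k mpoly set)"
          using genideal_self[OF carr] gv(2) by blast
        then have "monomial g \<otimes>\<^bsub>poly_ring n\<^esub> Poly_Mapping.single v c \<in> Idl\<^bsub>poly_ring n\<^esub> (monomial ` G)"
          by (rule I.I_r_closed) (use gv in auto)
        then show ?thesis by (simp add: gv monomial_def mult_single)
      qed
      have "sum (\<lambda>a. Poly_Mapping.single a (Poly_Mapping.lookup p a)) B \<in> Idl\<^bsub>poly_ring n\<^esub> (monomial ` G)"
        if "B \<subseteq> Poly_Mapping.keys p" "finite B" for B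
        using that(2,1)
      proof (induction B rule: finite_induct)
        case empty
        show ?case using I.zero_closed by simp
      next
        case (insert b B)
        then have "b \<in> ?E" using p by (auto simp: mono_span_iff)
        with insert show ?case
          using I.a_closed[OF single[of b "Poly_Mapping.lookup p b"]] by simp
      qed
      then show "p \<in> Idl\<^bsub>poly_ring n\<^esub> (monomial ` G)"
        using poly_mapping_expand[of p] by (metis finite_keys order_refl)
    qed
  qed
qed

text \<open>For the converse, an up-closed \<open>E\<close> serves as its own set of generators:
  shifting it by exponents stays inside \<open>E\<close>, and the shift by \<open>0\<close> recovers
  all of it.\<close>

lemma monomial_ideal_iff: "monomial_ideal n I \<longleftrightarrow> (\<exists>E. upset n E \<and> I = mono_span E)"
proof
  assume "monomial_ideal n I"
  then obtain G where G: "G \<subseteq> exponents n" "I = Idl\<^bsub>poly_ring n\<^esub> (monomial ` G)"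
    by (auto simp: monomial_ideal_def)
  have "upset n {g + v |g v. g \<in> G \<and> v \<in> exponents n}"
    by (rule upset_generated[OF G(1)])
  then show "\<exists>E. upset n E \<and> I = mono_span E"
    using G genideal_monomials by blast
next
  assume "\<exists>E. upset n E \<and> I = mono_span E"
  then obtain E where E: "upset n E" "I = mono_span E" by blast
  have "{g + v |g v. g \<in> E \<and> v \<in> exponents n} = E"
  proof
    show "{g + v |g v. g \<in> E \<and> v \<in> exponents n} \<subseteq> E" using E(1) by (auto simp: upset_def)
    show "E \<subseteq> {g + v |g v. g \<in> E \<and> v \<in> exponents n}"
      by (metis (mono_tags, lifting) add.right_neutral mem_Collect_eq subsetI zero_in_exponents)
  qed
  moreover have "E \<subseteq> exponents n" using E(1) by (simp add: upset_def)
  ultimately show "monomial_ideal n I"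
    unfolding monomial_ideal_def E(2) using genideal_monomials[of E n] by metis
qed

text \<open>These are the monomials of the ideal generated by the variables in \<open>A\<close>. The
  zero ideal is the case of empty \<open>A\<close>, where the exponent set is empty.\<close>

definition var_exponents :: "nat \<Rightarrow> nat set \<Rightarrow> (nat \<Rightarrow>\<^sub>0 nat) set"
  where "var_exponents n A = {m \<in> exponents n. Poly_Mapping.keys m \<inter> A \<noteq> {}}"

lemma upset_var_exponents: "upset n (var_exponents n A)"
  by (auto simp: upset_def var_exponents_def keys_plus_nat)

lemma genideal_vars:
  assumes "A \<subseteq> {1..n}"
  shows "Idl\<^bsub>poly_ring n\<^esub> (X ` A) = (mono_span (var_exponents n A) :: ('k::field) mpoly set)"
proof -
  let ?G = "(\<lambda>i. Poly_Mapping.single i 1) ` A"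
  have G: "?G \<subseteq> exponents n" using assms by (auto simp: exponents_def)
  have X: "X ` A = (monomial ` ?G :: 'k mpoly set)" by (simp add: X_def image_image)
  have "{g + v |g v. g \<in> ?G \<and> v \<in> exponents n} = var_exponents n A"
  proof
    show "{g + v |g v. g \<in> ?G \<and> v \<in> exponents n} \<subseteq> var_exponents n A"
      using G by (auto simp: var_exponents_def keys_plus_nat)
    show "var_exponents n A \<subseteq> {g + v |g v. g \<in> ?G \<and> v \<in> exponents n}"
    proof
      fix m assume m: "m \<in> var_exponents n A"
      then obtain i where i: "i \<in> A" "i \<in> Poly_Mapping.keys m" by (auto simp: var_exponents_def)
      have eq: "m = Poly_Mapping.single i 1 + (m - Poly_Mapping.single i 1)"
        using i(2) by (intro poly_mapping_eqI)
          (auto simp: lookup_add lookup_minus lookup_single when_def in_keys_iff)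
      moreover have "m - Poly_Mapping.single i 1 \<in> exponents n"
        using m eq exponents_add_iff[of "Poly_Mapping.single i 1" "m - Poly_Mapping.single i 1" n]
        by (simp add: var_exponents_def)
      ultimately show "m \<in> {g + v |g v. g \<in> ?G \<and> v \<in> exponents n}" using i(1) by blast
    qed
  qed
  then show ?thesis using genideal_monomials[OF G] by (simp add: X)
qed

text \<open>Modulo the ideal, \<open>a\<close> and \<open>b\<close> may be replaced by their parts
  \<open>a0\<close> and \<open>b0\<close> free of the variables in \<open>A\<close>. The product
  \<open>a0 * b0\<close> is again free of them, so it lies in the ideal only if it vanishes, and
  then a factor vanishes because polynomials form a domain.\<close>

lemma primeideal_vars:
  assumes "A \<subseteq> {1..n}"
  shows "primeideal (mono_span (var_exponents n A) :: ('k::field) mpoly set) (poly_ring n)"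
proof (rule primeidealI[OF ideal_mono_span[OF upset_var_exponents] cring_poly_ring])
  have "(1 :: 'k mpoly) \<in> carrier (poly_ring n)" "(1 :: 'k mpoly) \<notin> mono_span (var_exponents n A)"
    by (auto simp: mono_span_iff var_exponents_def)
  then show "carrier (poly_ring n) \<noteq> (mono_span (var_exponents n A) :: 'k mpoly set)" by blast
next
  fix a b :: "'k mpoly"
  let ?E = "var_exponents n A"
  assume a: "a \<in> carrier (poly_ring n)" and b: "b \<in> carrier (poly_ring n)"
    and ab: "a \<otimes>\<^bsub>poly_ring n\<^esub> b \<in> mono_span ?E"
  interpret P: ideal "mono_span ?E :: 'k mpoly set" "poly_ring n"
    by (rule ideal_mono_span[OF upset_var_exponents])
  obtain a0 a1 where sa: "a = a0 + a1" "Poly_Mapping.keys a0 \<subseteq> Poly_Mapping.keys a - ?E"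
    "Poly_Mapping.keys a1 \<subseteq> Poly_Mapping.keys a \<inter> ?E" by (rule poly_mapping_split)
  obtain b0 b1 where sb: "b = b0 + b1" "Poly_Mapping.keys b0 \<subseteq> Poly_Mapping.keys b - ?E"
    "Poly_Mapping.keys b1 \<subseteq> Poly_Mapping.keys b \<inter> ?E" by (rule poly_mapping_split)
  have in1: "a1 \<in> mono_span ?E" "b1 \<in> mono_span ?E"
    using sa sb by (auto simp: mono_span_iff)
  have in0: "a0 \<in> carrier (poly_ring n)" "b0 \<in> carrier (poly_ring n)"
    using sa sb a b by auto
  have "a1 * b \<in> mono_span ?E" "a0 * b1 \<in> mono_span ?E"
    using P.I_r_closed[OF in1(1) b] P.I_l_closed[OF in1(2) in0(1)] by auto
  moreover have "a0 * b0 = a * b - (a1 * b + a0 * b1)"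
    unfolding sa sb by (simp add: algebra_simps)
  ultimately have "a0 * b0 \<in> mono_span ?E"
    using ab by (simp add: mono_span_iff keys_add_subset keys_diff_subset)
  moreover have "Poly_Mapping.keys (a0 * b0) \<inter> ?E = {}"
  proof -
    have "Poly_Mapping.keys u \<inter> A = {}" if "u \<in> Poly_Mapping.keys a0 \<union> Poly_Mapping.keys b0" for u
      using that sa(2) sb(2) a b by (auto simp: var_exponents_def)
    then show ?thesis
      using keys_mult[of a0 b0] by (fastforce simp: var_exponents_def keys_plus_nat)
  qed
  ultimately have "a0 * b0 = 0" by (auto simp: mono_span_iff simp flip: keys_eq_empty)
  then show "a \<in> mono_span ?E \<or> b \<in> mono_span ?E"
    using in1 sa sb by auto
qed

lemma monomial_prime_iff:
  "monomial_prime n P \<longleftrightarrow> (\<exists>A\<subseteq>{1..n}. P = mono_span (var_exponents n A))"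
  unfolding monomial_prime_def using genideal_vars primeideal_vars by metis

section \<open>Prime filtrations in terms of exponent sets\<close>

lemma zero_in_mono_span [simp]: "0 \<in> mono_span E"
  by (simp add: mono_span_iff)

lemma mono_span_add: "p \<in> mono_span E \<Longrightarrow> q \<in> mono_span E \<Longrightarrow> p + q \<in> mono_span E"
  by (simp add: mono_span_iff keys_add_subset)

lemma mono_span_diff: "p \<in> mono_span E \<Longrightarrow> q \<in> mono_span E \<Longrightarrow> p - q \<in> mono_span E"
  by (simp add: mono_span_iff keys_diff_subset)

lemma mono_span_mult:
  assumes "upset n E" "p \<in> mono_span E" "r \<in> carrier (poly_ring n)"
  shows "r * p \<in> mono_span E"
  using ideal.I_l_closed[OF ideal_mono_span[OF assms(1)] assms(2,3)] by simp

lemma in_coset_iff: "p \<in> mono_span E +>\<^bsub>poly_ring n\<^esub> x \<longleftrightarrow> p - x \<in> mono_span E"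
  by (auto simp: a_r_coset_def') (metis diff_add_cancel)

lemma coset_eq_iff:
  "mono_span E +>\<^bsub>poly_ring n\<^esub> x = mono_span E +>\<^bsub>poly_ring n\<^esub> y \<longleftrightarrow> x - y \<in> mono_span E"
proof
  assume eq: "mono_span E +>\<^bsub>poly_ring n\<^esub> x = mono_span E +>\<^bsub>poly_ring n\<^esub> y"
  have "x \<in> mono_span E +>\<^bsub>poly_ring n\<^esub> x" by (simp add: in_coset_iff)
  then show "x - y \<in> mono_span E" unfolding eq by (simp add: in_coset_iff)
next
  assume xy: "x - y \<in> mono_span E"
  have "p - x \<in> mono_span E \<longleftrightarrow> p - y \<in> mono_span E" for p
    using mono_span_add[OF _ xy, of "p - x"] mono_span_diff[OF _ xy, of "p - y"] by auto
  then show "mono_span E +>\<^bsub>poly_ring n\<^esub> x = mono_span E +>\<^bsub>poly_ring n\<^esub> y"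
    by (auto simp: in_coset_iff)
qed

lemma coset_zero: "mono_span E +>\<^bsub>poly_ring n\<^esub> 0 = mono_span E"
  by (auto simp: in_coset_iff)

lemma coset_set_add:
  "set_add (poly_ring n) (mono_span E +>\<^bsub>poly_ring n\<^esub> x) (mono_span E +>\<^bsub>poly_ring n\<^esub> y)
    = mono_span E +>\<^bsub>poly_ring n\<^esub> (x + y)"
proof (intro equalityI subsetI)
  fix p assume "p \<in> set_add (poly_ring n) (mono_span E +>\<^bsub>poly_ring n\<^esub> x) (mono_span E +>\<^bsub>poly_ring n\<^esub> y)"
  then obtain a b where "p = a + b" "a - x \<in> mono_span E" "b - y \<in> mono_span E"
    by (auto simp: set_add_def' in_coset_iff)
  then show "p \<in> mono_span E +>\<^bsub>poly_ring n\<^esub> (x + y)"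
    using mono_span_add[of "a - x" E "b - y"] by (simp add: in_coset_iff algebra_simps)
next
  fix p assume "p \<in> mono_span E +>\<^bsub>poly_ring n\<^esub> (x + y)"
  then have "p - y \<in> mono_span E +>\<^bsub>poly_ring n\<^esub> x" "y \<in> mono_span E +>\<^bsub>poly_ring n\<^esub> y"
    by (simp_all add: in_coset_iff algebra_simps)
  moreover have "p = (p - y) + y" by simp
  ultimately show "p \<in> set_add (poly_ring n) (mono_span E +>\<^bsub>poly_ring n\<^esub> x) (mono_span E +>\<^bsub>poly_ring n\<^esub> y)"
    unfolding set_add_def' by force
qed

text \<open>Two representatives of a coset differ by an element of the ideal, and so do their
  multiples by \<open>r\<close>. All cosets in the union defining scalar multiplication thus
  coincide.\<close>

lemma coset_smult:
  assumes "upset n E" "r \<in> carrier (poly_ring n)"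
  shows "(\<Union>z\<in>mono_span E +>\<^bsub>poly_ring n\<^esub> x. mono_span E +>\<^bsub>poly_ring n\<^esub> (r \<otimes>\<^bsub>poly_ring n\<^esub> z))
    = mono_span E +>\<^bsub>poly_ring n\<^esub> (r * x)"
proof -
  have "mono_span E +>\<^bsub>poly_ring n\<^esub> (r \<otimes>\<^bsub>poly_ring n\<^esub> z) = mono_span E +>\<^bsub>poly_ring n\<^esub> (r * x)"
    if "z \<in> mono_span E +>\<^bsub>poly_ring n\<^esub> x" for z
    using mono_span_mult[OF assms(1) _ assms(2), of "z - x"] that
    by (simp add: coset_eq_iff in_coset_iff algebra_simps)
  moreover have "x \<in> mono_span E +>\<^bsub>poly_ring n\<^esub> x" by (simp add: in_coset_iff)
  ultimately show ?thesis by blast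
qed

lemma lookup_map_int [simp]: "Poly_Mapping.lookup (Poly_Mapping.map int m) i = int (Poly_Mapping.lookup m i)"
  by (simp add: Poly_Mapping.map.rep_eq when_def)

lemma map_int_add: "Poly_Mapping.map int (a + b) = Poly_Mapping.map int a + Poly_Mapping.map int b"
  by (rule poly_mapping_eqI) (simp add: lookup_add)

lemma map_int_eq_iff [simp]: "Poly_Mapping.map int a = Poly_Mapping.map int b \<longleftrightarrow> a = b"
  by (simp add: poly_mapping_eq_iff fun_eq_iff)

lemma map_int_zero [simp]: "Poly_Mapping.map int 0 = 0"
  by (rule poly_mapping_eqI) simp

lemma map_int_in_mdegrees: "m \<in> exponents n \<Longrightarrow> Poly_Mapping.map int m \<in> mdegrees n"
  by (auto simp: exponents_def mdegrees_def in_keys_iff)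

lemma quot_module_simps:
  "carrier (quot_module n I J) = {J +>\<^bsub>poly_ring n\<^esub> x | x. x \<in> I}"
  "add (quot_module n I J) = set_add (poly_ring n)"
  "smult (quot_module n I J) = (\<lambda>r A. \<Union>x\<in>A. J +>\<^bsub>poly_ring n\<^esub> (r \<otimes>\<^bsub>poly_ring n\<^esub> x))"
  "component (quot_module n I J) = (\<lambda>b. {J +>\<^bsub>poly_ring n\<^esub> x | x. x \<in> I \<inter> poly_component n b})"
  by (simp_all add: quot_module_def)

lemma shift_simps:
  "carrier (shift M a) = carrier M" "add (shift M a) = add M" "smult (shift M a) = smult M"
  "component (shift M a) = (\<lambda>b. component M (a + b))"
  by (simp_all add: shift_def)

text \<open>
  For the ideals \<open>J \<subseteq> I\<close> with exponent sets \<open>E \<subseteq> F\<close> and for \<open>u = x\<^sup>m\<close> this says that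
  \<open>I = J + (u)\<close> and that \<open>J : u\<close> is generated by the variables in \<open>A\<close>.
\<close>

definition prime_step :: "nat \<Rightarrow> (nat \<Rightarrow>\<^sub>0 nat) set \<Rightarrow> (nat \<Rightarrow>\<^sub>0 nat) set \<Rightarrow> (nat \<Rightarrow>\<^sub>0 nat) \<Rightarrow> nat set \<Rightarrow> bool"
  where "prime_step n E F m A \<longleftrightarrow> m \<in> exponents n \<and> F = E \<union> (+) m ` exponents n \<and>
    (\<forall>v\<in>exponents n. m + v \<in> E \<longleftrightarrow> v \<in> var_exponents n A)"

text \<open>The preimage of the class of \<open>1\<close> generates \<open>I/J\<close>, and its
  annihilator is \<open>P\<close>. As it can be chosen homogeneous of degree \<open>a\<close>, it is
  a scalar times a single monomial, whose exponent is the required \<open>m\<close>.\<close>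

lemma prime_step_if_graded_isomorphic:
  fixes n :: nat and A :: "nat set" and E F :: "(nat \<Rightarrow>\<^sub>0 nat) set"
  assumes E: "upset n E" and F: "upset n F" and "E \<subseteq> F"
    and iso: "graded_isomorphic (poly_ring n) (quot_module n (mono_span F :: ('k::field) mpoly set) (mono_span E))
      (shift (quot_module n (carrier (poly_ring n)) (mono_span (var_exponents n A))) (- a))"
  shows "\<exists>m. prime_step n E F m A"
proof -
  let ?J = "mono_span E :: 'k mpoly set" and ?I = "mono_span F :: 'k mpoly set"
    and ?P = "mono_span (var_exponents n A) :: 'k mpoly set"
  let ?R = "poly_ring n :: 'k mpoly ring"
  note up = upset_var_exponents[of n A]
  note cosets = coset_eq_iff[where E = E and n = n] coset_eq_iff[where E = "var_exponents n A" and n = n]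
  note smults = coset_smult[OF E] coset_smult[OF up]
  obtain f where bij: "bij_betw f {?J +>\<^bsub>?R\<^esub> x |x. x \<in> ?I} {?P +>\<^bsub>?R\<^esub> x |x. x \<in> carrier ?R}"
    and smult0: "\<And>r C. r \<in> carrier ?R \<Longrightarrow> C \<in> {?J +>\<^bsub>?R\<^esub> x |x. x \<in> ?I} \<Longrightarrow>
      f (\<Union>x\<in>C. ?J +>\<^bsub>?R\<^esub> (r \<otimes>\<^bsub>?R\<^esub> x)) = (\<Union>x\<in>f C. ?P +>\<^bsub>?R\<^esub> (r \<otimes>\<^bsub>?R\<^esub> x))"
    and comp: "\<And>b. f ` {?J +>\<^bsub>?R\<^esub> x |x. x \<in> ?I \<inter> poly_component n b}
      = {?P +>\<^bsub>?R\<^esub> x |x. x \<in> carrier ?R \<inter> poly_component n (- a + b)}"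
  proof -
    obtain f where f: "bij_betw f (carrier (quot_module n ?I ?J))
        (carrier (shift (quot_module n (carrier ?R) ?P) (- a)))"
      "\<forall>r\<in>carrier ?R. \<forall>x\<in>carrier (quot_module n ?I ?J).
        f (r \<odot>\<^bsub>quot_module n ?I ?J\<^esub> x) = r \<odot>\<^bsub>shift (quot_module n (carrier ?R) ?P) (- a)\<^esub> f x"
      "\<forall>b. f ` component (quot_module n ?I ?J) b
        = component (shift (quot_module n (carrier ?R) ?P) (- a)) b"
      using iso unfolding graded_isomorphic_def by blast
    note f' = f[unfolded quot_module_simps shift_simps]
    show thesis by (rule that[OF f'(1)]) (use f'(2,3) in blast)+
  qed
  have mem: "?J +>\<^bsub>?R\<^esub> x \<in> {?J +>\<^bsub>?R\<^esub> x |x. x \<in> ?I}" if "x \<in> ?I" for x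
    unfolding mem_Collect_eq by (rule exI[of _ x], rule conjI[OF refl that])
  have smult: "f (?J +>\<^bsub>?R\<^esub> (r * x)) = ?P +>\<^bsub>?R\<^esub> (r * s)"
    if "r \<in> carrier ?R" "x \<in> ?I" "f (?J +>\<^bsub>?R\<^esub> x) = ?P +>\<^bsub>?R\<^esub> s" for r x s
  proof -
    from smult0[OF that(1) mem[OF that(2)]] show ?thesis
      unfolding that(3) smults(1)[OF that(1)] smults(2)[OF that(1)] .
  qed
  have inj: "f (?J +>\<^bsub>?R\<^esub> x) = f (?J +>\<^bsub>?R\<^esub> y) \<longleftrightarrow> x - y \<in> ?J" if "x \<in> ?I" "y \<in> ?I" for x y
  proof -
    have "f (?J +>\<^bsub>?R\<^esub> x) = f (?J +>\<^bsub>?R\<^esub> y) \<longleftrightarrow> ?J +>\<^bsub>?R\<^esub> x = ?J +>\<^bsub>?R\<^esub> y"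
      by (rule inj_on_eq_iff[OF bij_betw_imp_inj_on[OF bij] mem[OF that(1)] mem[OF that(2)]])
    then show ?thesis unfolding cosets(1) .
  qed
  have ex: "\<exists>s\<in>carrier ?R. f (?J +>\<^bsub>?R\<^esub> x) = ?P +>\<^bsub>?R\<^esub> s" if "x \<in> ?I" for x
    using bij_betw_imp_surj_on[OF bij] that by blast
  have I0: "0 \<in> ?I" by simp
  have f0: "f (?J +>\<^bsub>?R\<^esub> 0) = ?P +>\<^bsub>?R\<^esub> 0"
    using ex[OF I0] smult[of 0 0] I0 by auto
  \<comment> \<open>The class of \<open>1\<close> has degree \<open>0 = - a + a\<close>, so its
    preimage has a representative \<open>x\<close> in degree \<open>a\<close>.\<close>
  have "?P +>\<^bsub>?R\<^esub> 1 \<in> {?P +>\<^bsub>?R\<^esub> x |x. x \<in> carrier ?R \<inter> poly_component n (- a + a)}"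
    by (force simp: poly_component_def)
  then obtain x where x: "x \<in> ?I" "x \<in> poly_component n a" "f (?J +>\<^bsub>?R\<^esub> x) = ?P +>\<^bsub>?R\<^esub> 1"
    unfolding comp[of a, symmetric] by auto
  have mult_I: "r * x \<in> ?I" if "r \<in> carrier ?R" for r
    using mono_span_mult[OF F] x(1) that by blast
  have fx: "f (?J +>\<^bsub>?R\<^esub> (r * x)) = ?P +>\<^bsub>?R\<^esub> r" if "r \<in> carrier ?R" for r
    using smult[OF that x(1,3)] by simp
  have colon: "r * x \<in> ?J \<longleftrightarrow> r \<in> ?P" if "r \<in> carrier ?R" for r
  proof -
    have "r * x \<in> ?J \<longleftrightarrow> f (?J +>\<^bsub>?R\<^esub> (r * x)) = f (?J +>\<^bsub>?R\<^esub> 0)"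
      using inj[OF mult_I[OF that] I0] by simp
    also have "\<dots> \<longleftrightarrow> r \<in> ?P" by (simp only: fx[OF that] f0 cosets(2) diff_zero)
    finally show ?thesis .
  qed
  have "1 \<notin> ?P" by (auto simp: mono_span_iff var_exponents_def)
  then have "x \<noteq> 0" using colon[of 1] by auto
  then obtain m where m: "m \<in> Poly_Mapping.keys x" by (auto simp flip: keys_eq_empty)
  define c where "c = Poly_Mapping.lookup x m"
  have c: "c \<noteq> 0" using m by (simp add: c_def in_keys_iff)
  \<comment> \<open>Distinct exponents have distinct degrees, so the homogeneous \<open>x\<close>
    consists of one term.\<close>
  have "Poly_Mapping.keys x \<subseteq> {m}"
    using x(2) m unfolding poly_component_def by (metis (mono_tags, lifting) map_int_eq_iff mem_Collect_eq insertI1 subsetI)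
  then have xm: "x = Poly_Mapping.single m c"
    using m by (subst poly_mapping_expand[of x]) (auto simp: c_def dest: subset_singletonD)
  have mF: "m \<in> F" using x(1) m by (auto simp: mono_span_iff)
  have "m \<in> exponents n" using mF F by (auto simp: upset_def)
  moreover have "m + v \<in> E \<longleftrightarrow> v \<in> var_exponents n A" if "v \<in> exponents n" for v
    using colon[of "Poly_Mapping.single v 1"] that c
    by (simp add: xm mult_single single_in_mono_span add.commute)
  moreover have "F = E \<union> (+) m ` exponents n"
  proof
    show "E \<union> (+) m ` exponents n \<subseteq> F"
      using \<open>E \<subseteq> F\<close> mF F by (auto simp: upset_def)
    show "F \<subseteq> E \<union> (+) m ` exponents n"
    proof
      fix w assume w: "w \<in> F"
      let ?w = "Poly_Mapping.single w 1 :: 'k mpoly"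
      have wI: "?w \<in> ?I" using w by (simp add: mono_span_iff)
      from ex[OF wI] obtain s where s: "s \<in> carrier ?R" "f (?J +>\<^bsub>?R\<^esub> ?w) = ?P +>\<^bsub>?R\<^esub> s" by blast
      have "?w - s * x \<in> ?J"
        using inj[OF wI mult_I[OF s(1)]] fx[OF s(1)] s(2) by simp
      \<comment> \<open>An exponent outside \<open>E\<close> cannot occur in the difference. There
        \<open>s * x\<close> must cancel the term with exponent \<open>w\<close>, and every exponent
        of \<open>s * x\<close> is a translate by \<open>m\<close>.\<close>
      then have "w \<in> E \<or> Poly_Mapping.lookup (?w - s * x) w = 0"
        by (auto simp: mono_span_iff in_keys_iff)
      then show "w \<in> E \<union> (+) m ` exponents n"
      proof
        assume "Poly_Mapping.lookup (?w - s * x) w = 0"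
        then have "w \<in> Poly_Mapping.keys (x * s)"
          by (simp add: lookup_minus in_keys_iff mult.commute)
        then have "w \<in> (+) m ` Poly_Mapping.keys s" using keys_single_mult[OF c, of m s] xm by simp
        then show ?thesis using s(1) by auto
      qed simp
    qed
  qed
  ultimately show ?thesis unfolding prime_step_def by blast
qed

text \<open>The terms of \<open>y\<close> outside \<open>E\<close> are divisible by the generator
  with exponent \<open>m\<close>, and \<open>s\<close> collects their quotients. The clause on the
  support of \<open>s\<close> records that a homogeneous \<open>y\<close> gives a homogeneous
  \<open>s\<close>, which makes the isomorphism built from it graded.\<close>

lemma prime_step_decompose:
  fixes y :: "('k::field) mpoly"
  assumes step: "prime_step n E F m A" and y: "y \<in> mono_span F"
  shows "\<exists>s. Poly_Mapping.keys s \<subseteq> {v \<in> exponents n. m + v \<in> Poly_Mapping.keys y} \<and>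
    y - s * Poly_Mapping.single m 1 \<in> mono_span E"
proof -
  let ?c = "Poly_Mapping.lookup y" and ?K = "Poly_Mapping.keys y"
  \<comment> \<open>The truncated difference \<open>w - m\<close> is exact here, since every
    exponent of \<open>F\<close> outside \<open>E\<close> has the form \<open>m + v\<close>.\<close>
  define s where "s = (\<Sum>w\<in>?K - E. Poly_Mapping.single (w - m) (?c w))"
  have w: "w - m \<in> exponents n" "m + (w - m) = w" if "w \<in> ?K - E" for w
  proof -
    have "w \<in> (+) m ` exponents n" using that step y by (auto simp: prime_step_def mono_span_iff)
    then obtain v where "v \<in> exponents n" "w = m + v" by blast
    then show "w - m \<in> exponents n" "m + (w - m) = w" by simp_all
  qed
  have "Poly_Mapping.keys s \<subseteq> (\<Union>w\<in>?K - E. {w - m})"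
    unfolding s_def by (rule order.trans[OF keys_sum]) auto
  then have "Poly_Mapping.keys s \<subseteq> {v \<in> exponents n. m + v \<in> ?K}"
  proof -
    assume keys: "Poly_Mapping.keys s \<subseteq> (\<Union>w\<in>?K - E. {w - m})"
    show ?thesis
    proof
      fix v assume "v \<in> Poly_Mapping.keys s"
      then obtain w where "w \<in> ?K - E" "v = w - m" using keys by blast
      then show "v \<in> {v \<in> exponents n. m + v \<in> ?K}" using w[of w] by simp
    qed
  qed
  moreover have "s * Poly_Mapping.single m 1 = (\<Sum>w\<in>?K - E. Poly_Mapping.single w (?c w))"
    unfolding s_def sum_distrib_right mult_single
    by (intro sum.cong refl) (metis w(2) add.commute mult.right_neutral)
  then have "y - s * Poly_Mapping.single m 1 = (\<Sum>w\<in>?K \<inter> E. Poly_Mapping.single w (?c w))"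
    by (subst poly_mapping_expand[of y]) (subst sum.Int_Diff[of _ _ E], simp_all)
  then have "y - s * Poly_Mapping.single m 1 \<in> mono_span E"
    using keys_sum[of "\<lambda>w. Poly_Mapping.single w (?c w)" "?K \<inter> E"] by (auto simp: mono_span_iff)
  ultimately show ?thesis by blast
qed

text \<open>Multiplication by the generator \<open>u\<close> maps \<open>S\<close> onto
  \<open>I/J\<close> with kernel \<open>J : u = P\<close>. The map constructed is the inverse of the
  induced isomorphism, and the shift is the degree of \<open>u\<close>.\<close>

lemma graded_isomorphic_if_prime_step:
  fixes n :: nat and A :: "nat set" and E F :: "(nat \<Rightarrow>\<^sub>0 nat) set"
  assumes E: "upset n E" and step: "prime_step n E F m A"
  shows "graded_isomorphic (poly_ring n) (quot_module n (mono_span F :: ('k::field) mpoly set) (mono_span E))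
      (shift (quot_module n (carrier (poly_ring n)) (mono_span (var_exponents n A))) (- Poly_Mapping.map int m))"
proof -
  let ?J = "mono_span E :: 'k mpoly set" and ?I = "mono_span F :: 'k mpoly set"
    and ?P = "mono_span (var_exponents n A) :: 'k mpoly set"
  let ?R = "poly_ring n :: 'k mpoly ring" and ?a = "Poly_Mapping.map int m"
  let ?u = "Poly_Mapping.single m 1 :: 'k mpoly"
  note up = upset_var_exponents[of n A]
  note cosets = coset_eq_iff[where E = E and n = n] coset_eq_iff[where E = "var_exponents n A" and n = n]
  note smults = coset_smult[OF E] coset_smult[OF up]
  note adds = coset_set_add[where E = E and n = n] coset_set_add[where E = "var_exponents n A" and n = n]
  note cosets_in = in_coset_iff[where E = E and n = n] in_coset_iff[where E = "var_exponents n A" and n = n]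
  have m: "m \<in> exponents n" using step by (simp add: prime_step_def)
  have colon: "s * ?u \<in> ?J \<longleftrightarrow> s \<in> ?P" if "s \<in> carrier ?R" for s
  proof -
    have "Poly_Mapping.keys (s * ?u) = (+) m ` Poly_Mapping.keys s"
      using keys_single_mult[of "1::'k" m s] by (simp add: mult.commute)
    then have "s * ?u \<in> ?J \<longleftrightarrow> (\<forall>v\<in>Poly_Mapping.keys s. m + v \<in> E)"
      by (simp add: mono_span_iff image_subset_iff)
    also have "\<dots> \<longleftrightarrow> (\<forall>v\<in>Poly_Mapping.keys s. v \<in> var_exponents n A)"
      using that step unfolding prime_step_def by (intro ball_cong refl) auto
    finally show ?thesis by (auto simp: mono_span_iff)
  qed
  have P_carr: "p \<in> carrier ?R" if "p \<in> ?P" for p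
    using that by (auto simp: mono_span_iff var_exponents_def)
  have uI: "s * ?u \<in> ?I" if "s \<in> carrier ?R" for s
    using that keys_single_mult[of "1::'k" m s] step
    by (auto simp: mult.commute mono_span_iff prime_step_def)
  have carr_add: "p + q \<in> carrier ?R" "p - q \<in> carrier ?R" if "p \<in> carrier ?R" "q \<in> carrier ?R" for p q
    using that by (simp_all add: keys_add_subset keys_diff_subset)
  have carr_mult: "p * q \<in> carrier ?R" if "p \<in> carrier ?R" "q \<in> carrier ?R" for p q
    using that by (simp add: keys_mult_exponents)
  \<comment> \<open>The preimage of a coset under multiplication by \<open>u\<close>. As a set it
    needs no choice of representative, and it turns out to be a coset of \<open>?P\<close>.\<close>
  define f where "f C = {s \<in> carrier ?R. s * ?u \<in> C}" for C
  \<comment> \<open>By \<open>colon\<close>, two elements \<open>s\<close> with \<open>s * u\<close>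
    congruent to \<open>y\<close> differ by an element of \<open>?P\<close>, so any one of them
    describes the whole preimage.\<close>
  have f: "f (?J +>\<^bsub>?R\<^esub> y) = ?P +>\<^bsub>?R\<^esub> s" if s: "s \<in> carrier ?R" and ys: "y - s * ?u \<in> ?J" for y s
  proof (intro equalityI subsetI)
    fix t assume "t \<in> f (?J +>\<^bsub>?R\<^esub> y)"
    then have t: "t \<in> carrier ?R" "t * ?u - y \<in> ?J" by (auto simp: f_def cosets_in)
    have "(t - s) * ?u \<in> ?J"
      using mono_span_add[of "t * ?u - y" E, OF t(2) ys] by (simp add: algebra_simps)
    then show "t \<in> ?P +>\<^bsub>?R\<^esub> s" using colon[OF carr_add(2)[OF t(1) s]] by (simp add: cosets_in)
  next
    fix t assume "t \<in> ?P +>\<^bsub>?R\<^esub> s"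
    then have ts: "t - s \<in> ?P" by (simp add: cosets_in)
    then have t: "t \<in> carrier ?R" using carr_add(1)[OF P_carr[OF ts] s] by simp
    have "(t - s) * ?u \<in> ?J" using ts colon[OF carr_add(2)[OF t s]] by blast
    then have "t * ?u - y \<in> ?J"
      using mono_span_diff[of "(t - s) * ?u" E "y - s * ?u"] ys by (simp add: algebra_simps)
    then show "t \<in> f (?J +>\<^bsub>?R\<^esub> y)" using t by (simp add: f_def cosets_in)
  qed
  have dec: "\<exists>s. Poly_Mapping.keys s \<subseteq> {v \<in> exponents n. m + v \<in> Poly_Mapping.keys y} \<and> s \<in> carrier ?R \<and>
      y - s * ?u \<in> ?J" if y: "y \<in> ?I" for y
  proof -
    obtain s where "Poly_Mapping.keys s \<subseteq> {v \<in> exponents n. m + v \<in> Poly_Mapping.keys y}"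
      "y - s * ?u \<in> ?J"
      using prime_step_decompose[OF step y] by blast
    then show ?thesis by (intro exI[of _ s]) auto
  qed
  let ?M = "{?J +>\<^bsub>?R\<^esub> x |x. x \<in> ?I}" and ?N = "{?P +>\<^bsub>?R\<^esub> x |x. x \<in> carrier ?R}"
  have bij: "bij_betw f ?M ?N"
  proof (rule bij_betwI')
    fix C D assume "C \<in> ?M" "D \<in> ?M"
    then obtain y z where C: "C = ?J +>\<^bsub>?R\<^esub> y" "y \<in> ?I" and D: "D = ?J +>\<^bsub>?R\<^esub> z" "z \<in> ?I" by blast
    obtain s t where s: "s \<in> carrier ?R" "y - s * ?u \<in> ?J" and t: "t \<in> carrier ?R" "z - t * ?u \<in> ?J"
      using dec[OF C(2)] dec[OF D(2)] by blast
    have "f C = f D \<longleftrightarrow> s - t \<in> ?P" unfolding C D f[OF s] f[OF t] by (rule cosets)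
    also have "\<dots> \<longleftrightarrow> (s - t) * ?u \<in> ?J" using colon[OF carr_add(2)[OF s(1) t(1)]] by simp
    also have "\<dots> \<longleftrightarrow> y - z \<in> ?J"
    proof -
      have d: "(y - s * ?u) - (z - t * ?u) \<in> ?J"
        using mono_span_diff s(2) t(2) by blast
      have e: "y - z = (s - t) * ?u + ((y - s * ?u) - (z - t * ?u))"
        "(s - t) * ?u = (y - z) - ((y - s * ?u) - (z - t * ?u))" by (simp_all add: algebra_simps)
      show ?thesis
        using mono_span_add[of "(s - t) * ?u" E, OF _ d]
          mono_span_diff[of "y - z" E, OF _ d] e by metis
    qed
    also have "\<dots> \<longleftrightarrow> C = D" unfolding C D by (rule cosets[symmetric])
    finally show "f C = f D \<longleftrightarrow> C = D" .
  next
    fix C assume "C \<in> ?M"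
    then obtain y where C: "C = ?J +>\<^bsub>?R\<^esub> y" "y \<in> ?I" by blast
    then show "f C \<in> ?N" using dec[OF C(2)] f by blast
  next
    fix D assume "D \<in> ?N"
    then obtain s where s: "D = ?P +>\<^bsub>?R\<^esub> s" "s \<in> carrier ?R" by blast
    then have "D = f (?J +>\<^bsub>?R\<^esub> (s * ?u))" using f[of s "s * ?u"] by simp
    then show "\<exists>C\<in>?M. D = f C" using uI[OF s(2)] by blast
  qed
  have add: "f (set_add ?R C D) = set_add ?R (f C) (f D)" if "C \<in> ?M" "D \<in> ?M" for C D
  proof -
    obtain y z where C: "C = ?J +>\<^bsub>?R\<^esub> y" "y \<in> ?I" and D: "D = ?J +>\<^bsub>?R\<^esub> z" "z \<in> ?I" using \<open>C \<in> ?M\<close> \<open>D \<in> ?M\<close> by blast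
    obtain s t where s: "s \<in> carrier ?R" "y - s * ?u \<in> ?J" and t: "t \<in> carrier ?R" "z - t * ?u \<in> ?J"
      using dec[OF C(2)] dec[OF D(2)] by blast
    have "(y + z) - (s + t) * ?u \<in> ?J"
      using mono_span_add[of "y - s * ?u" E "z - t * ?u"] s t by (simp add: algebra_simps)
    then show ?thesis
      unfolding C D f[OF s] f[OF t] adds by (rule f[OF carr_add(1)[OF s(1) t(1)]])
  qed
  have smult: "f (\<Union>x\<in>C. ?J +>\<^bsub>?R\<^esub> (r \<otimes>\<^bsub>?R\<^esub> x)) = (\<Union>x\<in>f C. ?P +>\<^bsub>?R\<^esub> (r \<otimes>\<^bsub>?R\<^esub> x))"
    if r: "r \<in> carrier ?R" and "C \<in> ?M" for r C
  proof -
    obtain y where C: "C = ?J +>\<^bsub>?R\<^esub> y" "y \<in> ?I" using \<open>C \<in> ?M\<close> by blast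
    obtain s where s: "s \<in> carrier ?R" "y - s * ?u \<in> ?J" using dec[OF C(2)] by blast
    have "r * y - (r * s) * ?u \<in> ?J"
      using mono_span_mult[OF E _ r, of "y - s * ?u"] s by (simp add: algebra_simps)
    then show ?thesis
      unfolding C f[OF s] smults(1)[OF r] smults(2)[OF r] by (rule f[OF carr_mult[OF r s(1)]])
  qed
  have comp: "f ` {?J +>\<^bsub>?R\<^esub> x |x. x \<in> ?I \<inter> poly_component n b}
      = {?P +>\<^bsub>?R\<^esub> x |x. x \<in> carrier ?R \<inter> poly_component n (- ?a + b)}" for b
  proof (intro equalityI subsetI)
    fix D assume "D \<in> f ` {?J +>\<^bsub>?R\<^esub> x |x. x \<in> ?I \<inter> poly_component n b}"
    then obtain y where y: "D = f (?J +>\<^bsub>?R\<^esub> y)" "y \<in> ?I" "y \<in> poly_component n b" by blast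
    obtain s where s: "Poly_Mapping.keys s \<subseteq> {v \<in> exponents n. m + v \<in> Poly_Mapping.keys y}"
      "s \<in> carrier ?R" "y - s * ?u \<in> ?J" using dec[OF y(2)] by blast
    have "Poly_Mapping.map int v = - ?a + b" if "v \<in> Poly_Mapping.keys s" for v
    proof -
      have "Poly_Mapping.map int (m + v) = b" using that s(1) y(3) by (auto simp: poly_component_def)
      then show ?thesis by (auto simp: map_int_add)
    qed
    then have "s \<in> poly_component n (- ?a + b)" using s(2) by (auto simp: poly_component_def)
    then show "D \<in> {?P +>\<^bsub>?R\<^esub> x |x. x \<in> carrier ?R \<inter> poly_component n (- ?a + b)}"
      using s f y by blast
  next
    fix D assume "D \<in> {?P +>\<^bsub>?R\<^esub> x |x. x \<in> carrier ?R \<inter> poly_component n (- ?a + b)}"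
    then obtain s where s: "D = ?P +>\<^bsub>?R\<^esub> s" "s \<in> carrier ?R" "s \<in> poly_component n (- ?a + b)" by blast
    have keys: "Poly_Mapping.keys (s * ?u) = (+) m ` Poly_Mapping.keys s"
      using keys_single_mult[of "1::'k" m s] by (simp add: mult.commute)
    have "s * ?u \<in> poly_component n b"
      using s(3) m unfolding poly_component_def by (auto simp: keys map_int_add)
    moreover have "D = f (?J +>\<^bsub>?R\<^esub> (s * ?u))" using f[of s "s * ?u"] s by simp
    ultimately show "D \<in> f ` {?J +>\<^bsub>?R\<^esub> x |x. x \<in> ?I \<inter> poly_component n b}"
      using uI[OF s(2)] by blast
  qed
  show ?thesis
    unfolding graded_isomorphic_def quot_module_simps shift_simps
    using bij add smult comp by (intro exI[of _ f] conjI ballI allI)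
qed

section \<open>Setting the last variable to one\<close>

text \<open>Exponents of both rings share one type, so deleting a coordinate means setting it to
  zero.\<close>

definition drop_var :: "nat \<Rightarrow> (nat \<Rightarrow>\<^sub>0 nat) \<Rightarrow> (nat \<Rightarrow>\<^sub>0 nat)"
  where "drop_var i m = Poly_Mapping.update i 0 m"

lemma lookup_drop_var: "Poly_Mapping.lookup (drop_var i m) j = (if j = i then 0 else Poly_Mapping.lookup m j)"
  by (simp add: drop_var_def lookup_update)

lemma drop_var_add: "drop_var i (a + b) = drop_var i a + drop_var i b"
  by (rule poly_mapping_eqI) (simp add: lookup_drop_var lookup_add)

lemma drop_var_decompose: "drop_var i m + Poly_Mapping.single i (Poly_Mapping.lookup m i) = m"
  by (rule poly_mapping_eqI) (simp add: lookup_drop_var lookup_add lookup_single when_def)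

lemma drop_var_single [simp]: "drop_var i (Poly_Mapping.single i j) = 0"
  by (rule poly_mapping_eqI) (simp add: lookup_drop_var lookup_single when_def)

lemma drop_var_in_exponents: "m \<in> exponents (Suc k) \<Longrightarrow> drop_var (Suc k) m \<in> exponents k"
  by (auto simp: exponents_def in_keys_iff lookup_drop_var subset_iff le_Suc_eq split: if_splits)

lemma exponents_mono: "m \<in> exponents k \<Longrightarrow> m \<in> exponents (Suc k)"
  by (auto simp: exponents_def)

lemma drop_var_id: "m \<in> exponents k \<Longrightarrow> drop_var (Suc k) m = m"
  by (rule poly_mapping_eqI) (auto simp: exponents_def lookup_drop_var in_keys_iff subset_iff)

lemma single_in_exponents: "i \<in> {1..n} \<Longrightarrow> Poly_Mapping.single i j \<in> exponents n"
  by (auto simp: exponents_def)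

text \<open>The fibre over \<open>v\<close> consists of the exponents of \<open>x^v\<close> times
  powers of the last variable. Membership in the image is therefore membership after multiplication
  by some power of that variable.\<close>

lemma image_drop_var_iff:
  assumes "upset (Suc k) E" "v \<in> exponents k"
  shows "v \<in> drop_var (Suc k) ` E \<longleftrightarrow> (\<exists>j. v + Poly_Mapping.single (Suc k) j \<in> E)"
proof
  assume "v \<in> drop_var (Suc k) ` E"
  then obtain e where "e \<in> E" "v = drop_var (Suc k) e" by blast
  then show "\<exists>j. v + Poly_Mapping.single (Suc k) j \<in> E"
    using drop_var_decompose[of "Suc k" e] by metis
next
  assume "\<exists>j. v + Poly_Mapping.single (Suc k) j \<in> E"
  then obtain j where "v + Poly_Mapping.single (Suc k) j \<in> E" by blast
  moreover have "v = drop_var (Suc k) (v + Poly_Mapping.single (Suc k) j)"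
    by (simp add: drop_var_add drop_var_id[OF assms(2)])
  ultimately show "v \<in> drop_var (Suc k) ` E" by blast
qed

lemma upset_add: "upset n E \<Longrightarrow> e \<in> E \<Longrightarrow> v \<in> exponents n \<Longrightarrow> e + v \<in> E"
  by (simp add: upset_def)

lemma upset_drop_var:
  assumes "upset (Suc k) E"
  shows "upset k (drop_var (Suc k) ` E)"
  unfolding upset_def
proof (intro conjI ballI)
  show "drop_var (Suc k) ` E \<subseteq> exponents k"
    using assms drop_var_in_exponents by (auto simp: upset_def)
next
  fix e v assume "e \<in> drop_var (Suc k) ` E" and v: "v \<in> exponents k"
  then obtain d where d: "d \<in> E" "e = drop_var (Suc k) d" by blast
  have "e + v = drop_var (Suc k) (d + v)" by (simp add: d drop_var_add drop_var_id[OF v])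
  then show "e + v \<in> drop_var (Suc k) ` E"
    using upset_add[OF assms d(1) exponents_mono[OF v]] by blast
qed

lemma drop_var_exponents: "drop_var (Suc k) ` exponents (Suc k) = exponents k"
proof
  show "exponents k \<subseteq> drop_var (Suc k) ` exponents (Suc k)"
    using drop_var_id exponents_mono by (metis image_eqI subsetI)
qed (auto intro: drop_var_in_exponents)

lemma image_drop_var_step:
  assumes "prime_step (Suc k) E F m A"
  shows "drop_var (Suc k) ` F = drop_var (Suc k) ` E \<union> (+) (drop_var (Suc k) m) ` exponents k"
proof -
  have F: "F = E \<union> (+) m ` exponents (Suc k)" using assms by (simp add: prime_step_def)
  have "drop_var (Suc k) ` F =
      drop_var (Suc k) ` E \<union> (\<lambda>v. drop_var (Suc k) m + drop_var (Suc k) v) ` exponents (Suc k)"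
    unfolding F image_Un image_image drop_var_add ..
  also have "(\<lambda>v. drop_var (Suc k) m + drop_var (Suc k) v) ` exponents (Suc k)
      = (+) (drop_var (Suc k) m) ` exponents k"
    unfolding drop_var_exponents[of k, symmetric] image_image ..
  finally show ?thesis .
qed

text \<open>As \<open>J : u\<close> contains the last variable, \<open>u\<close> times that variable
  lies in \<open>J\<close>. It has the same image as \<open>u\<close>, so the generator adds nothing
  to the image of \<open>J\<close>.\<close>

lemma prime_step_drop_var_trivial:
  assumes E: "upset (Suc k) E" and step: "prime_step (Suc k) E F m A" and "Suc k \<in> A"
  shows "drop_var (Suc k) ` F = drop_var (Suc k) ` E"
proof -
  let ?e = "Poly_Mapping.single (Suc k) (1 :: nat)"
  have "?e \<in> var_exponents (Suc k) A"
    using \<open>Suc k \<in> A\<close> by (simp add: var_exponents_def single_in_exponents)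
  then have "m + ?e \<in> E" using step single_in_exponents[of "Suc k" "Suc k" 1] by (simp add: prime_step_def)
  then have "drop_var (Suc k) (m + ?e) \<in> drop_var (Suc k) ` E" by blast
  then have "drop_var (Suc k) m \<in> drop_var (Suc k) ` E" by (simp add: drop_var_add)
  then show ?thesis
    using upset_add[OF upset_drop_var[OF E]] unfolding image_drop_var_step[OF step] by blast
qed

text \<open>Membership in the image of \<open>E\<close> allows an arbitrary power of the last
  variable. Such a power absorbs the difference between \<open>m\<close> and
  \<open>drop_var (Suc k) m\<close>, and it does not affect membership in an ideal generated by
  other variables.\<close>

lemma prime_step_drop_var:
  assumes E: "upset (Suc k) E" and step: "prime_step (Suc k) E F m A" and A: "Suc k \<notin> A"
  shows "prime_step k (drop_var (Suc k) ` E) (drop_var (Suc k) ` F) (drop_var (Suc k) m) A"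
  unfolding prime_step_def
proof (intro conjI ballI)
  let ?e = "Poly_Mapping.single (Suc k) :: nat \<Rightarrow> nat \<Rightarrow>\<^sub>0 nat"
  have m: "m \<in> exponents (Suc k)" using step by (simp add: prime_step_def)
  show "drop_var (Suc k) m \<in> exponents k" by (rule drop_var_in_exponents[OF m])
  show "drop_var (Suc k) ` F = drop_var (Suc k) ` E \<union> (+) (drop_var (Suc k) m) ` exponents k"
    by (rule image_drop_var_step[OF step])
  fix v assume v: "v \<in> exponents k"
  have e: "?e j \<in> exponents (Suc k)" for j by (rule single_in_exponents) simp
  have colon: "m + w \<in> E \<longleftrightarrow> w \<in> var_exponents (Suc k) A" if "w \<in> exponents (Suc k)" for w
    using step that by (simp add: prime_step_def)
  have var: "v + ?e j \<in> var_exponents (Suc k) A \<longleftrightarrow> v \<in> var_exponents k A" for j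
    using v exponents_mono[OF v] A e[of j] by (auto simp: var_exponents_def keys_plus_nat split: if_splits)
  have "drop_var (Suc k) m + v \<in> drop_var (Suc k) ` E \<longleftrightarrow> (\<exists>j. drop_var (Suc k) m + v + ?e j \<in> E)"
    using image_drop_var_iff[OF E, of "drop_var (Suc k) m + v"] v drop_var_in_exponents[OF m] by simp
  also have "\<dots> \<longleftrightarrow> (\<exists>j. m + (v + ?e j) \<in> E)"
  proof
    assume "\<exists>j. drop_var (Suc k) m + v + ?e j \<in> E"
    then obtain j where "drop_var (Suc k) m + v + ?e j \<in> E" by blast
    then have "drop_var (Suc k) m + v + ?e j + ?e (Poly_Mapping.lookup m (Suc k)) \<in> E"
      by (rule upset_add[OF E _ e])
    moreover have "drop_var (Suc k) m + v + ?e j + ?e (Poly_Mapping.lookup m (Suc k)) = m + (v + ?e j)"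
      by (subst (3) drop_var_decompose[of "Suc k" m, symmetric]) (simp add: ac_simps)
    ultimately show "\<exists>j. m + (v + ?e j) \<in> E" by metis
  next
    \<comment> \<open>In this direction the power of the last variable contained in \<open>m\<close>
      is moved into the witness, which becomes \<open>lookup m (Suc k) + j\<close>.\<close>
    assume "\<exists>j. m + (v + ?e j) \<in> E"
    then obtain j where "m + (v + ?e j) \<in> E" by blast
    moreover have "m + (v + ?e j) = drop_var (Suc k) m + v + ?e (Poly_Mapping.lookup m (Suc k) + j)"
      by (subst (1) drop_var_decompose[of "Suc k" m, symmetric]) (simp add: single_add ac_simps)
    ultimately show "\<exists>j. drop_var (Suc k) m + v + ?e j \<in> E" by metis
  qed
  also have "\<dots> \<longleftrightarrow> v \<in> var_exponents k A"
    using colon e exponents_mono[OF v] by (simp add: var)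
  finally show "drop_var (Suc k) m + v \<in> drop_var (Suc k) ` E \<longleftrightarrow> v \<in> var_exponents k A" .
qed

section \<open>The homomorphism on monomial ideals\<close>

context
  fixes k :: nat and \<phi> :: "('k::field) mpoly \<Rightarrow> 'k mpoly"
  assumes hom: "\<phi> \<in> algebra_hom (Suc k) k"
    and X: "\<forall>i\<in>{1..k}. \<phi> (X i) = X i" and X_last: "\<phi> (X (Suc k)) = 1"
begin

lemma specialize_ring_hom: "\<phi> \<in> ring_hom (poly_ring (Suc k)) (poly_ring k)"
  using hom by (simp add: algebra_hom_def)

lemma specialize_mult:
  "p \<in> carrier (poly_ring (Suc k)) \<Longrightarrow> q \<in> carrier (poly_ring (Suc k)) \<Longrightarrow> \<phi> (p * q) = \<phi> p * \<phi> q"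
  using ring_hom_mult[OF specialize_ring_hom, of p q] by simp

lemma specialize_add:
  "p \<in> carrier (poly_ring (Suc k)) \<Longrightarrow> q \<in> carrier (poly_ring (Suc k)) \<Longrightarrow> \<phi> (p + q) = \<phi> p + \<phi> q"
  using ring_hom_add[OF specialize_ring_hom, of p q] by simp

lemma specialize_zero: "\<phi> 0 = 0"
  using hom by (auto simp: algebra_hom_def const_def dest: spec[of _ 0])

text \<open>Induction on the total degree: a variable occurring in \<open>m\<close> is split off,
  which is where the prescribed values of \<phi> on the variables enter.\<close>

lemma specialize_monomial:
  assumes "m \<in> exponents (Suc k)"
  shows "\<phi> (monomial m) = monomial (drop_var (Suc k) m)"
  using assms
proof (induction "sum (Poly_Mapping.lookup m) {1..Suc k}" arbitrary: m)
  case 0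
  then have "Poly_Mapping.lookup m i = 0" for i
  proof (cases "i \<in> {1..Suc k}")
    case True
    have "\<forall>j\<in>{1..Suc k}. Poly_Mapping.lookup m j = 0" using 0(1) by (simp del: sum.cl_ivl_Suc)
    then show ?thesis using True by blast
  next
    case False
    then show ?thesis using 0(2) unfolding exponents_def by (metis mem_Collect_eq not_in_keys_iff_lookup_eq_zero subsetD)
  qed
  then have "m = 0" by (intro poly_mapping_eqI) simp
  moreover have "drop_var (Suc k) 0 = 0" by (rule drop_var_id) simp
  ultimately show ?case
    using ring_hom_one[OF specialize_ring_hom] by (simp add: monomial_def)
next
  case (Suc N m)
  then obtain i where i: "i \<in> {1..Suc k}" "Poly_Mapping.lookup m i \<noteq> 0"
    by (metis nat.distinct(1) sum.neutral)
  define m' where "m' = m - Poly_Mapping.single i 1"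
  have m: "m = Poly_Mapping.single i 1 + m'"
    using i(2) by (intro poly_mapping_eqI) (auto simp: m'_def lookup_add lookup_minus lookup_single when_def)
  have m': "m' \<in> exponents (Suc k)" using Suc.prems unfolding m by simp
  have "sum (Poly_Mapping.lookup m) {1..Suc k}
      = sum (Poly_Mapping.lookup (Poly_Mapping.single i 1)) {1..Suc k} + sum (Poly_Mapping.lookup m') {1..Suc k}"
    unfolding m lookup_add sum.distrib ..
  moreover have "sum (Poly_Mapping.lookup (Poly_Mapping.single i (1::nat))) {1..Suc k} = 1"
    using i(1) by (subst sum.remove[of _ i]) (auto simp: lookup_single when_def)
  ultimately have "N = sum (Poly_Mapping.lookup m') {1..Suc k}" using Suc.hyps(2) by simp
  then have IH: "\<phi> (monomial m') = monomial (drop_var (Suc k) m')" using Suc.hyps(1) m' by blast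
  have Xi: "\<phi> (X i) = monomial (drop_var (Suc k) (Poly_Mapping.single i 1))"
  proof (cases "i = Suc k")
    case True
    then show ?thesis using X_last by (simp add: monomial_def)
  next
    case False
    then have "i \<in> {1..k}" using i(1) by auto
    then show ?thesis using X drop_var_id[OF single_in_exponents, of i k 1] by (simp add: X_def)
  qed
  have "\<phi> (monomial m) = \<phi> (X i * monomial m')"
    by (simp add: m X_def monomial_def mult_single)
  also have "\<dots> = \<phi> (X i) * \<phi> (monomial m')"
    using single_in_exponents[OF i(1)] m' by (intro specialize_mult) (auto simp: X_def monomial_def)
  also have "\<dots> = monomial (drop_var (Suc k) m)"
    unfolding Xi IH unfolding m by (simp add: monomial_def mult_single drop_var_add)
  finally show ?case .
qed

lemma specialize_single:
  assumes "m \<in> exponents (Suc k)"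
  shows "\<phi> (Poly_Mapping.single m c) = Poly_Mapping.single (drop_var (Suc k) m) c"
proof -
  have "\<phi> (Poly_Mapping.single m c) = \<phi> (const c * monomial m)"
    by (simp add: const_def monomial_def mult_single)
  also have "\<dots> = \<phi> (const c) * \<phi> (monomial m)"
    using assms by (intro specialize_mult) (auto simp: const_def monomial_def)
  also have "\<phi> (const c) = const c" using hom by (simp add: algebra_hom_def)
  finally show ?thesis
    unfolding specialize_monomial[OF assms] by (simp add: const_def monomial_def mult_single)
qed

lemma specialize_sum:
  assumes "finite B" "B \<subseteq> exponents (Suc k)"
  shows "\<phi> (\<Sum>m\<in>B. Poly_Mapping.single m (c m)) = (\<Sum>m\<in>B. Poly_Mapping.single (drop_var (Suc k) m) (c m))"
  using assms
proof (induction B rule: finite_induct)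
  case empty
  show ?case by (simp add: specialize_zero)
next
  case (insert b B)
  have "Poly_Mapping.keys (\<Sum>m\<in>B. Poly_Mapping.single m (c m)) \<subseteq> exponents (Suc k)"
    by (rule order.trans[OF keys_sum]) (use insert.prems in \<open>auto split: if_splits\<close>)
  then show ?case
    using insert by (simp add: specialize_add specialize_single)
qed

text \<open>Exponents of \<open>E\<close> that differ only in the last coordinate are merged by
  \<phi>. Cancellation among merged terms only shrinks the support, so one inclusion is immediate;
  the other needs an explicit lift of each polynomial.\<close>

lemma specialize_mono_span:
  assumes "E \<subseteq> exponents (Suc k)"
  shows "\<phi> ` mono_span E = mono_span (drop_var (Suc k) ` E)"
proof (intro equalityI subsetI)
  fix q assume "q \<in> \<phi> ` mono_span E"
  then obtain p where p: "q = \<phi> p" "Poly_Mapping.keys p \<subseteq> E" by (auto simp: mono_span_iff)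
  have "q = (\<Sum>m\<in>Poly_Mapping.keys p. Poly_Mapping.single (drop_var (Suc k) m) (Poly_Mapping.lookup p m))"
    using specialize_sum[OF finite_keys order.trans[OF p(2) assms], of "Poly_Mapping.lookup p"]
    unfolding p(1) poly_mapping_expand[of p, symmetric] .
  then have "Poly_Mapping.keys q \<subseteq> (\<Union>m\<in>Poly_Mapping.keys p. {drop_var (Suc k) m})"
    using keys_sum[of "\<lambda>m. Poly_Mapping.single (drop_var (Suc k) m) (Poly_Mapping.lookup p m)" "Poly_Mapping.keys p"]
    by (auto split: if_splits)
  then show "q \<in> mono_span (drop_var (Suc k) ` E)" using p(2) by (auto simp: mono_span_iff)
next
  fix q :: "'k mpoly" assume "q \<in> mono_span (drop_var (Suc k) ` E)"
  then have q: "Poly_Mapping.keys q \<subseteq> drop_var (Suc k) ` E" by (simp add: mono_span_iff)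
  \<comment> \<open>One exponent of \<open>E\<close> is chosen over each exponent of
    \<open>q\<close>. Injectivity on \<open>B\<close> prevents merging, so the lift \<open>p\<close>
    can carry the coefficients of \<open>q\<close> unchanged.\<close>
  then obtain B where B: "B \<subseteq> E" "inj_on (drop_var (Suc k)) B" "Poly_Mapping.keys q = drop_var (Suc k) ` B"
    by (meson subset_image_inj)
  define p where "p = (\<Sum>m\<in>B. Poly_Mapping.single m (Poly_Mapping.lookup q (drop_var (Suc k) m)))"
  have fin: "finite B" using B(2,3) by (metis finite_imageD finite_keys)
  have "\<phi> p = (\<Sum>m\<in>B. Poly_Mapping.single (drop_var (Suc k) m) (Poly_Mapping.lookup q (drop_var (Suc k) m)))"
    unfolding p_def by (rule specialize_sum[OF fin order.trans[OF B(1) assms]])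
  also have "\<dots> = (\<Sum>w\<in>Poly_Mapping.keys q. Poly_Mapping.single w (Poly_Mapping.lookup q w))"
    unfolding B(3) using B(2) by (simp add: sum.reindex)
  also have "\<dots> = q" by (rule poly_mapping_expand[symmetric])
  finally have "q = \<phi> p" by simp
  moreover have "p \<in> mono_span E"
    unfolding p_def mono_span_iff by (rule order.trans[OF keys_sum]) (use B(1) in \<open>auto split: if_splits\<close>)
  ultimately show "q \<in> \<phi> ` mono_span E" by blast
qed

end

text \<open>For discarding the trivial steps after specialization. The index map \<open>g\<close>
  remembers the original step behind each surviving one, and with it the prime; that
  \<open>H\<close> takes values of \<open>G\<close> transfers up-closedness.\<close>

lemma chain_remove_repetitions:
  fixes G :: "nat \<Rightarrow> 'a" and R :: "nat \<Rightarrow> 'a \<Rightarrow> 'a \<Rightarrow> bool"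
  assumes "\<forall>j\<in>{1..r}. G (j - 1) = G j \<or> R j (G (j - 1)) (G j)"
  shows "\<exists>(s::nat) g H. H 0 = G 0 \<and> H s = G r \<and> (\<forall>j\<le>s. H j \<in> G ` {..r}) \<and>
    (\<forall>j\<in>{1..s}. g j \<in> {1..r} \<and> R (g j) (H (j - 1)) (H j))"
  using assms
proof (induction r)
  case 0
  show ?case by (rule exI[of _ 0], rule exI[of _ id], rule exI[of _ G]) auto
next
  case (Suc r)
  then have "\<forall>j\<in>{1..r}. G (j - 1) = G j \<or> R j (G (j - 1)) (G j)" by simp
  from Suc.IH[OF this] obtain s :: nat and g H where IH: "H 0 = G 0" "H s = G r" "\<forall>j\<le>s. H j \<in> G ` {..r}"
    "\<forall>j\<in>{1..s}. g j \<in> {1..r} \<and> R (g j) (H (j - 1)) (H j)" by blast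
  from Suc.prems have "G r = G (Suc r) \<or> R (Suc r) (G r) (G (Suc r))" by (auto dest: bspec[of _ _ "Suc r"])
  then show ?case
  proof
    assume "G r = G (Suc r)"
    then show ?thesis using IH by (intro exI[of _ s], intro exI[of _ g], intro exI[of _ H]) fastforce
  next
    assume R: "R (Suc r) (G r) (G (Suc r))"
    let ?g = "g(Suc s := Suc r)" and ?H = "H(Suc s := G (Suc r))"
    have "?g j \<in> {1..Suc r} \<and> R (?g j) (?H (j - 1)) (?H j)" if "j \<in> {1..Suc s}" for j
    proof (cases "j = Suc s")
      case False
      then have "j \<in> {1..s}" using that by auto
      then have "g j \<in> {1..r} \<and> R (g j) (H (j - 1)) (H j)" "j - 1 \<noteq> Suc s" "j \<noteq> Suc s"
        using IH(4) by auto
      then show ?thesis by simp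
    qed (use R IH(2) in simp)
    moreover have "?H j \<in> G ` {..Suc r}" if "j \<le> Suc s" for j
      using that IH(3) by (cases "j = Suc s") (auto simp: le_Suc_eq)
    ultimately show ?thesis
      using IH(1) by (intro exI[of _ "Suc s"] exI[of _ ?g] exI[of _ ?H] conjI ballI allI impI) simp_all
  qed
qed

text \<open>Here the modules disappear, each graded isomorphism being replaced by a
  \<open>prime_step\<close>. The top of the chain becomes all of \<open>exponents n\<close> because
  a span determines its exponent set.\<close>

lemma prime_filtration_exponents:
  assumes "prime_filtration n I r F P"
  obtains E A where "\<forall>j\<le>r. upset n (E j) \<and> F j = mono_span (E j)" "E r = exponents n"
    "\<forall>j\<in>{1..r}. A j \<subseteq> {1..n} \<and> P j = mono_span (var_exponents n (A j)) \<and>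
      (\<exists>m. prime_step n (E (j - 1)) (E j) m (A j))"
proof -
  have filt: "F r = carrier (poly_ring n)" "\<And>j. j \<le> r \<Longrightarrow> monomial_ideal n (F j)"
    "\<And>j. j \<in> {1..r} \<Longrightarrow> F (j - 1) \<subset> F j"
    "\<And>j. j \<in> {1..r} \<Longrightarrow> monomial_prime n (P j)"
    "\<And>j. j \<in> {1..r} \<Longrightarrow> \<exists>a\<in>mdegrees n. graded_isomorphic (poly_ring n)
      (quot_module n (F j) (F (j - 1))) (shift (quot_module n (carrier (poly_ring n)) (P j)) (- a))"
    using assms unfolding prime_filtration_def by (elim conjE, simp only: atLeastAtMost_iff; blast)+
  have "\<forall>j\<in>{..r}. \<exists>E. upset n E \<and> F j = mono_span E"
    using filt(2) by (simp add: monomial_ideal_iff)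
  then obtain E where E: "\<forall>j\<in>{..r}. upset n (E j) \<and> F j = mono_span (E j)"
    by (rule bchoice[THEN exE])
  have "\<forall>j\<in>{1..r}. \<exists>A. A \<subseteq> {1..n} \<and> P j = mono_span (var_exponents n A)"
    using filt(4) by (simp add: monomial_prime_iff)
  then obtain A where A: "\<forall>j\<in>{1..r}. A j \<subseteq> {1..n} \<and> P j = mono_span (var_exponents n (A j))"
    by (rule bchoice[THEN exE])
  have "\<exists>m. prime_step n (E (j - 1)) (E j) m (A j)" if j: "j \<in> {1..r}" for j
  proof -
    have Ej: "upset n (E j)" "F j = mono_span (E j)"
      and Ej': "upset n (E (j - 1))" "F (j - 1) = mono_span (E (j - 1))"
      using E j by auto
    have P: "P j = mono_span (var_exponents n (A j))" using A j by blast
    obtain a where "graded_isomorphic (poly_ring n) (quot_module n (F j) (F (j - 1)))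
        (shift (quot_module n (carrier (poly_ring n)) (P j)) (- a))" using filt(5)[OF j] by blast
    moreover have "E (j - 1) \<subseteq> E j"
      using filt(3)[OF j] unfolding Ej(2) Ej'(2) psubset_eq mono_span_subset_iff by blast
    ultimately show ?thesis
      unfolding P Ej(2) Ej'(2) by (intro prime_step_if_graded_isomorphic[OF Ej'(1) Ej(1)])
  qed
  moreover have "mono_span (E r) = (mono_span (exponents n) :: 'a mpoly set)"
    using E filt(1) unfolding carrier_eq_mono_span by simp
  then have "E r = exponents n" unfolding mono_span_eq_iff .
  ultimately show ?thesis
    using E A by (intro that[of E A]) simp_all
qed

lemma prime_filtration_mono_span:
  fixes E :: "nat \<Rightarrow> (nat \<Rightarrow>\<^sub>0 nat) set"
  assumes up: "\<forall>j\<le>r. upset n (E j)" and Er: "E r = exponents n"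
    and step: "\<forall>j\<in>{1..r}. A j \<subseteq> {1..n} \<and> (\<exists>m. prime_step n (E (j - 1)) (E j) m (A j))"
  shows "prime_filtration n (mono_span (E 0) :: ('k::field) mpoly set) r
    (\<lambda>j. mono_span (E j)) (\<lambda>j. mono_span (var_exponents n (A j)))"
  unfolding prime_filtration_def
proof (intro conjI allI impI ballI)
  show "mono_span (E r) = carrier (poly_ring n :: 'k mpoly ring)" unfolding Er carrier_eq_mono_span ..
  show "monomial_ideal n (mono_span (E j) :: 'k mpoly set)" if "j \<le> r" for j
    using up that monomial_ideal_iff by blast
  fix j assume j: "j \<in> {1..r}"
  then obtain m where m: "prime_step n (E (j - 1)) (E j) m (A j)" and A: "A j \<subseteq> {1..n}" using step by blast
  show "monomial_prime n (mono_span (var_exponents n (A j)) :: 'k mpoly set)"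
    using A monomial_prime_iff by blast
  have me: "m \<in> exponents n" using m by (simp add: prime_step_def)
  have "m + 0 \<in> E j" using m zero_in_exponents unfolding prime_step_def by blast
  \<comment> \<open>A variable ideal does not contain \<open>1\<close>, so the generator is outside
    the smaller ideal. This makes the inclusion strict.\<close>
  moreover have "m + 0 \<notin> E (j - 1)"
  proof -
    have "0 \<notin> var_exponents n (A j)" by (simp add: var_exponents_def)
    then show ?thesis using m zero_in_exponents unfolding prime_step_def by blast
  qed
  moreover have "E (j - 1) \<subseteq> E j" using m by (auto simp: prime_step_def)
  ultimately show "mono_span (E (j - 1)) \<subset> (mono_span (E j) :: 'k mpoly set)"
    unfolding psubset_eq mono_span_subset_iff mono_span_eq_iff by blast
  have "upset n (E (j - 1))" using up j by auto
  then show "\<exists>a\<in>mdegrees n. graded_isomorphic (poly_ring n)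
      (quot_module n (mono_span (E j) :: 'k mpoly set) (mono_span (E (j - 1))))
      (shift (quot_module n (carrier (poly_ring n)) (mono_span (var_exponents n (A j)))) (- a))"
    using graded_isomorphic_if_prime_step[OF _ m] map_int_in_mdegrees[OF me] by blast
qed simp

section \<open>Dimension of the residue class rings\<close>

lemma primeideal_quot_vimage:
  assumes "cring R" and I: "ideal I R" and p: "primeideal p (R Quot I)"
  shows "primeideal {x \<in> carrier R. I +>\<^bsub>R\<^esub> x \<in> p} R"
proof -
  interpret R: cring R by fact
  interpret h: ring_hom_ring R "R Quot I" "(+>\<^bsub>R\<^esub>) I" by (rule ideal.rcos_ring_hom_ring[OF I])
  interpret p: primeideal p "R Quot I" by fact
  show ?thesis
  proof (rule primeidealI[OF h.ideal_vimage[OF p.is_ideal] \<open>cring R\<close>])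
    show "carrier R \<noteq> {x \<in> carrier R. I +>\<^bsub>R\<^esub> x \<in> p}"
    proof
      assume "carrier R = {x \<in> carrier R. I +>\<^bsub>R\<^esub> x \<in> p}"
      then have "I +>\<^bsub>R\<^esub> \<one>\<^bsub>R\<^esub> \<in> p" using R.one_closed by blast
      then show False using p.one_imp_carrier p.I_notcarr h.hom_one by simp
    qed
    fix a b assume ab: "a \<in> carrier R" "b \<in> carrier R" "a \<otimes>\<^bsub>R\<^esub> b \<in> {x \<in> carrier R. I +>\<^bsub>R\<^esub> x \<in> p}"
    then have "(I +>\<^bsub>R\<^esub> a) \<otimes>\<^bsub>R Quot I\<^esub> (I +>\<^bsub>R\<^esub> b) \<in> p" by (simp flip: h.hom_mult)
    then show "a \<in> {x \<in> carrier R. I +>\<^bsub>R\<^esub> x \<in> p} \<or> b \<in> {x \<in> carrier R. I +>\<^bsub>R\<^esub> x \<in> p}"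
      using p.I_prime[OF h.hom_closed[OF ab(1)] h.hom_closed[OF ab(2)]] ab(1,2) by blast
  qed
qed

lemma carrier_quot: "carrier (R Quot I) = (+>\<^bsub>R\<^esub>) I ` carrier R"
  by (auto simp: FactRing_def A_RCOSETS_def')

text \<open>Since \<open>I\<close> is contained in \<open>q\<close>, membership in \<open>q\<close>
  does not depend on the representative of a coset. This keeps proper and strict inclusions visible
  in the quotient.\<close>

lemma coset_in_image_iff:
  assumes "cring R" and I: "ideal I R" and q: "ideal q R" and "I \<subseteq> q" and x: "x \<in> carrier R"
  shows "I +>\<^bsub>R\<^esub> x \<in> (+>\<^bsub>R\<^esub>) I ` q \<longleftrightarrow> x \<in> q"
proof
  interpret R: cring R by fact
  interpret q: ideal q R by fact
  assume "I +>\<^bsub>R\<^esub> x \<in> (+>\<^bsub>R\<^esub>) I ` q"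
  then obtain y where y: "y \<in> q" "I +>\<^bsub>R\<^esub> x = I +>\<^bsub>R\<^esub> y" by blast
  have yc: "y \<in> carrier R" using y(1) by (rule q.Icarr)
  have "x \<ominus>\<^bsub>R\<^esub> y \<in> q"
    using R.quotient_eq_iff_same_a_r_cos[OF I x yc] y(2) \<open>I \<subseteq> q\<close> by blast
  then have "(x \<ominus>\<^bsub>R\<^esub> y) \<oplus>\<^bsub>R\<^esub> y \<in> q" using y(1) by (rule q.a_closed)
  moreover have "(x \<ominus>\<^bsub>R\<^esub> y) \<oplus>\<^bsub>R\<^esub> y = x"
    using x yc by (simp add: R.minus_eq R.a_assoc R.l_neg)
  ultimately show "x \<in> q" by simp
qed blast

lemma primeideal_quot_image:
  assumes "cring R" and I: "ideal I R" and q: "primeideal q R" and "I \<subseteq> q"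
  shows "primeideal ((+>\<^bsub>R\<^esub>) I ` q) (R Quot I)"
proof -
  interpret R: cring R by fact
  interpret q: primeideal q R by fact
  interpret h: ring_hom_ring R "R Quot I" "(+>\<^bsub>R\<^esub>) I" by (rule ideal.rcos_ring_hom_ring[OF I])
  note mem = coset_in_image_iff[OF \<open>cring R\<close> I q.is_ideal \<open>I \<subseteq> q\<close>]
  show ?thesis
  proof (rule primeidealI[OF R.ring_ideal_imp_quot_ideal[OF I q.is_ideal] ideal.quotient_is_cring[OF I \<open>cring R\<close>]])
    have "\<one>\<^bsub>R\<^esub> \<notin> q" using q.one_imp_carrier q.I_notcarr by blast
    then have "I +>\<^bsub>R\<^esub> \<one>\<^bsub>R\<^esub> \<notin> (+>\<^bsub>R\<^esub>) I ` q" using mem by blast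
    then show "carrier (R Quot I) \<noteq> (+>\<^bsub>R\<^esub>) I ` q" using R.one_closed unfolding carrier_quot by blast
    fix C D assume C: "C \<in> carrier (R Quot I)" and D: "D \<in> carrier (R Quot I)"
      and CD: "C \<otimes>\<^bsub>R Quot I\<^esub> D \<in> (+>\<^bsub>R\<^esub>) I ` q"
    obtain a b where a: "a \<in> carrier R" "C = I +>\<^bsub>R\<^esub> a" and b: "b \<in> carrier R" "D = I +>\<^bsub>R\<^esub> b"
      using C D unfolding carrier_quot by blast
    have "I +>\<^bsub>R\<^esub> (a \<otimes>\<^bsub>R\<^esub> b) \<in> (+>\<^bsub>R\<^esub>) I ` q" using CD a b by (simp add: h.hom_mult)
    then have "a \<otimes>\<^bsub>R\<^esub> b \<in> q" using mem a(1) b(1) by blast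
    then have "a \<in> q \<or> b \<in> q" using q.I_prime a(1) b(1) by blast
    then show "C \<in> (+>\<^bsub>R\<^esub>) I ` q \<or> D \<in> (+>\<^bsub>R\<^esub>) I ` q" using a b by blast
  qed
qed

text \<open>Adjoining the variables outside \<open>A\<close> one at a time gives a chain of variable
  primes above \<open>P\<close>. Each newly adjoined variable witnesses strictness, also after
  passage to the quotient.\<close>

lemma krull_dim_vars_ge:
  assumes "A \<subseteq> {1..n}"
  shows "enat (card ({1..n} - A))
    \<le> krull_dim (poly_ring n Quot (mono_span (var_exponents n A) :: ('k::field) mpoly set))"
proof -
  let ?R = "poly_ring n :: 'k mpoly ring" and ?D = "{1..n} - A"
  let ?P = "\<lambda>A. mono_span (var_exponents n A) :: 'k mpoly set"
  obtain xs where xs: "set xs = ?D" "distinct xs" using finite_distinct_list[of ?D] by auto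
  have len: "length xs = card ?D" using xs distinct_card by metis
  define B where "B i = A \<union> set (take i xs)" for i
  have B: "B i \<subseteq> {1..n}" for i using xs(1) assms set_take_subset[of i xs] by (auto simp: B_def)
  note P_ideal = ideal_mono_span[OF upset_var_exponents, of n A, where 'k = 'k]
  have sub: "?P A \<subseteq> ?P (B i)" for i
    by (auto simp: mono_span_subset_iff var_exponents_def B_def)
  let ?p = "\<lambda>i. (+>\<^bsub>?R\<^esub>) (?P A) ` ?P (B i)"
  have prime: "primeideal (?p i) (?R Quot ?P A)" for i
    by (rule primeideal_quot_image[OF cring_poly_ring P_ideal primeideal_vars[OF B] sub])
  have strict: "?p i \<subset> ?p (Suc i)" if "i < card ?D" for i
  proof -
    have i: "i < length xs" using that len by simp
    let ?m = "Poly_Mapping.single (xs ! i) 1 :: nat \<Rightarrow>\<^sub>0 nat"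
    have "B i \<subseteq> B (Suc i)" by (auto simp: B_def take_Suc_conv_app_nth[OF i])
    then have "var_exponents n (B i) \<subseteq> var_exponents n (B (Suc i))"
      by (auto simp: var_exponents_def)
    then have "?P (B i) \<subseteq> ?P (B (Suc i))" by (simp add: mono_span_subset_iff)
    then have le: "?p i \<subseteq> ?p (Suc i)" by (rule image_mono)
    have xi: "xs ! i \<in> ?D" using xs(1) nth_mem[OF i] by blast
    have m: "?m \<in> exponents n" using xi by (intro single_in_exponents) simp
    have "xs ! i \<notin> set (take i xs)" using xs(2) i by (auto simp: in_set_conv_nth nth_eq_iff_index_eq)
    then have "xs ! i \<notin> B i" using xi by (simp add: B_def)
    then have "Poly_Mapping.single ?m 1 \<notin> ?P (B i)"
      by (simp add: mono_span_iff var_exponents_def)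
    then have "?P A +>\<^bsub>?R\<^esub> Poly_Mapping.single ?m 1 \<notin> ?p i"
      using coset_in_image_iff[OF cring_poly_ring P_ideal ideal_mono_span[OF upset_var_exponents] sub] m
      by simp
    moreover have "xs ! i \<in> B (Suc i)" by (simp add: B_def take_Suc_conv_app_nth[OF i])
    then have "Poly_Mapping.single ?m 1 \<in> ?P (B (Suc i))"
      using m by (simp add: mono_span_iff var_exponents_def)
    then have "?P A +>\<^bsub>?R\<^esub> Poly_Mapping.single ?m 1 \<in> ?p (Suc i)" by (rule imageI)
    ultimately show ?thesis using le by blast
  qed
  show ?thesis
    unfolding krull_dim_def
    by (intro Sup_upper CollectI exI[of _ "card ?D"] exI[of _ ?p] conjI refl allI impI)
      (rule prime, rule strict)
qed

section \<open>Ideals in terms of the arithmetic of the polynomial type\<close>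

lemma ideal_add:
  assumes "ideal J (poly_ring n)" "x \<in> J" "y \<in> J"
  shows "x + y \<in> J"
  using additive_subgroup.a_closed[OF ideal.axioms(1)[OF assms(1)] assms(2,3)] by simp

lemma ideal_diff:
  assumes "ideal J (poly_ring n)" "x \<in> J" "y \<in> J"
  shows "x - y \<in> J"
proof -
  have "\<ominus>\<^bsub>poly_ring n\<^esub> y \<in> J"
    by (rule additive_subgroup.a_inv_closed[OF ideal.axioms(1)[OF assms(1)] assms(3)])
  then show ?thesis
    using ideal_add[OF assms(1,2)] minus_poly_ring[OF ideal.Icarr[OF assms(1,3)]] by force
qed

lemma ideal_sum:
  assumes "ideal J (poly_ring n)" "\<And>x. x \<in> B \<Longrightarrow> f x \<in> J"
  shows "sum f B \<in> J"
  using assms(2)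
proof (induction B rule: infinite_finite_induct)
  case (insert b B)
  then show ?case using ideal_add[OF assms(1), of "f b" "sum f B"] by simp
qed (use additive_subgroup.zero_closed[OF ideal.axioms(1)[OF assms(1)]] in simp_all)

lemma carrier_ideal: "ideal (carrier (poly_ring n)) (poly_ring n)"
  unfolding carrier_eq_mono_span by (rule ideal_mono_span[OF upset_exponents])

lemma carrier_mult: "p \<in> carrier (poly_ring n) \<Longrightarrow> q \<in> carrier (poly_ring n) \<Longrightarrow> p * q \<in> carrier (poly_ring n)"
  by (simp add: keys_mult_exponents)

lemma carrier_power: "p \<in> carrier (poly_ring n) \<Longrightarrow> p ^ j \<in> carrier (poly_ring n)"
  by (induction j) (auto simp del: poly_ring_simps(1) intro: carrier_mult, simp)

lemma primeideal_power_cancel: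
  assumes "primeideal J (poly_ring n)" "a \<in> carrier (poly_ring n)" "a \<notin> J"
    and s: "s \<in> carrier (poly_ring n)" and "a ^ k * s \<in> J"
  shows "s \<in> J"
  using assms(5)
proof (induction k)
  case (Suc k)
  have "a \<otimes>\<^bsub>poly_ring n\<^esub> (a ^ k * s) \<in> J" using Suc.prems by (simp add: ac_simps)
  then show ?case
    using primeideal.I_prime[OF assms(1,2) carrier_mult[OF carrier_power[OF assms(2)] s]]
      assms(3) Suc.IH by blast
qed simp

lemma const_in_carrier: "const c \<in> carrier (poly_ring n)"
  by (simp add: const_def)

text \<open>Exponents form a list so that an induction along a chain of primes can split off
  \<open>y 0\<close> with the head, and so that bounded exponents are counted by lists of fixed
  length.\<close>

definition power_product :: "(nat \<Rightarrow> ('k::field) mpoly) \<Rightarrow> nat list \<Rightarrow> 'k mpoly"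
  where "power_product y bs = (\<Prod>i<length bs. y i ^ (bs ! i))"

lemma power_product_Nil [simp]: "power_product y [] = 1"
  by (simp add: power_product_def)

lemma power_product_Cons [simp]: "power_product y (b # bs) = y 0 ^ b * power_product (\<lambda>i. y (Suc i)) bs"
  by (simp add: power_product_def prod.lessThan_Suc_shift del: prod.lessThan_Suc)

lemma power_product_in_carrier:
  assumes "\<And>i. i < length bs \<Longrightarrow> y i \<in> carrier (poly_ring n)"
  shows "power_product y bs \<in> carrier (poly_ring n)"
  using assms
proof (induction bs arbitrary: y)
  case (Cons b bs)
  have "y 0 ^ b \<in> carrier (poly_ring n)" by (rule carrier_power) (use Cons.prems in simp)
  moreover have "power_product (\<lambda>i. y (Suc i)) bs \<in> carrier (poly_ring n)"
    by (rule Cons.IH) (use Cons.prems in simp)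
  ultimately show ?case unfolding power_product_Cons by (rule carrier_mult)
qed simp

text \<open>
  Elements \<open>y\<^sub>i \<in> q\<^sub>i\<^sub>+\<^sub>1 - q\<^sub>i\<close> along a chain of primes are algebraically independent modulo
  \<open>q\<^sub>0\<close>: divide a relation by the largest possible power of \<open>y\<^sub>0\<close> and reduce it modulo \<open>q\<^sub>1\<close>.
\<close>

lemma prime_chain_independent:
  fixes q :: "nat \<Rightarrow> ('k::field) mpoly set"
  assumes "\<And>i. i \<le> l \<Longrightarrow> primeideal (q i) (poly_ring n)"
    and "\<And>i. i < l \<Longrightarrow> q i \<subseteq> q (Suc i)"
    and "\<And>i. i < l \<Longrightarrow> y i \<in> q (Suc i) - q i"
    and "finite B" "\<And>bs. bs \<in> B \<Longrightarrow> length bs = l"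
    and "(\<Sum>bs\<in>B. const (c bs) * power_product y bs) \<in> q 0"
  shows "\<forall>bs\<in>B. c bs = 0"
  using assms
proof (induction l arbitrary: q y B c)
  case 0
  interpret q: primeideal "q 0" "poly_ring n" using 0(1) by simp
  have "B \<subseteq> {[]}" using 0(5) by auto
  show ?case
  proof (rule ccontr)
    assume "\<not> (\<forall>bs\<in>B. c bs = 0)"
    then have B: "B = {[]}" and c: "c [] \<noteq> 0" using \<open>B \<subseteq> {[]}\<close> by auto
    have "const (c []) \<in> q 0" using 0(6) by (simp add: B)
    then have "const (inverse (c [])) \<otimes>\<^bsub>poly_ring n\<^esub> const (c []) \<in> q 0"
      by (rule q.I_l_closed[OF _ const_in_carrier])
    then have "\<one>\<^bsub>poly_ring n\<^esub> \<in> q 0" using c by (simp add: const_def mult_single)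
    then show False using q.one_imp_carrier q.I_notcarr by simp
  qed
next
  case (Suc l)
  interpret q0: primeideal "q 0" "poly_ring n" using Suc.prems(1) by simp
  interpret q1: primeideal "q 1" "poly_ring n" using Suc.prems(1)[of 1] by simp
  let ?y = "\<lambda>i. y (Suc i)" and ?C = "carrier (poly_ring n :: 'k mpoly ring)"
  have y0: "y 0 \<in> q 1" "y 0 \<notin> q 0" using Suc.prems(3)[of 0] by auto
  have yC: "y i \<in> ?C" if "i < Suc l" for i
  proof -
    interpret p: primeideal "q (Suc i)" "poly_ring n" using Suc.prems(1)[of "Suc i"] that by simp
    show ?thesis using Suc.prems(3)[OF that] p.Icarr by blast
  qed
  show ?case
  proof (rule ccontr)
    assume nonzero: "\<not> (\<forall>bs\<in>B. c bs = 0)"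
    \<comment> \<open>Zero coefficients are removed first, so that the least exponent
      \<open>k\<close> of \<open>y 0\<close> is attained by a term with nonzero coefficient.\<close>
    define B' where "B' = {bs \<in> B. c bs \<noteq> 0}"
    have B': "finite B'" "B' \<noteq> {}" "B' \<subseteq> B"
      using nonzero Suc.prems(4) by (auto simp: B'_def)
    have len: "length bs = Suc l" if "bs \<in> B'" for bs using that B'(3) Suc.prems(5) by blast
    define k where "k = Min (hd ` B')"
    have k_le: "k \<le> hd bs" if "bs \<in> B'" for bs
      using that B'(1) by (simp add: k_def)
    define S1 where "S1 = {bs \<in> B'. hd bs = k}"
    let ?t = "\<lambda>bs. const (c bs) * power_product ?y (tl bs)"
    let ?s = "\<lambda>bs. y 0 ^ (hd bs - k) * ?t bs"
    have tC: "?t bs \<in> ?C" if "bs \<in> B'" for bs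
      by (intro carrier_mult const_in_carrier power_product_in_carrier yC) (use len[OF that] in simp)
    have sC: "?s bs \<in> ?C" if "bs \<in> B'" for bs
      by (intro carrier_mult[OF carrier_power tC] yC that) simp
    have "(\<Sum>bs\<in>B. const (c bs) * power_product y bs) = (\<Sum>bs\<in>B'. const (c bs) * power_product y bs)"
      by (rule sum.mono_neutral_right) (use Suc.prems(4) in \<open>auto simp: B'_def const_def\<close>)
    also have "\<dots> = (\<Sum>bs\<in>B'. y 0 ^ k * ?s bs)"
    proof (rule sum.cong[OF refl])
      fix bs assume bs: "bs \<in> B'"
      then have "bs = hd bs # tl bs" using len by (metis Zero_not_Suc length_0_conv list.exhaust_sel)
      then have "power_product y bs = y 0 ^ hd bs * power_product ?y (tl bs)"
        by (metis power_product_Cons)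
      also have "y 0 ^ hd bs = y 0 ^ k * y 0 ^ (hd bs - k)"
        using k_le[OF bs] by (simp flip: power_add)
      finally show "const (c bs) * power_product y bs = y 0 ^ k * ?s bs" by (simp add: ac_simps)
    qed
    also have "\<dots> = y 0 ^ k * sum ?s B'" by (simp add: sum_distrib_left)
    finally have in0: "y 0 ^ k * sum ?s B' \<in> q 0" using Suc.prems(6) by simp
    have sumC: "sum ?s B' \<in> ?C" by (rule ideal_sum[OF carrier_ideal sC])
    \<comment> \<open>The factor \<open>y 0 ^ k\<close> cancels because \<open>q 0\<close> is prime
      and does not contain \<open>y 0\<close>.\<close>
    have "sum ?s B' \<in> q 0"
      by (rule primeideal_power_cancel[OF q0.primeideal yC y0(2) sumC in0]) simp
    then have in1: "sum ?s B' \<in> q 1" using Suc.prems(2)[of 0] by auto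
    \<comment> \<open>These terms still contain a factor \<open>y 0\<close>, which lies in
      \<open>q 1\<close>. Modulo \<open>q 1\<close> only the terms of \<open>S1\<close>, free of
      \<open>y 0\<close>, remain, and they form a relation for the shorter chain.\<close>
    have "sum ?s (B' - S1) \<in> q 1"
    proof (rule ideal_sum[OF q1.is_ideal])
      fix bs assume bs: "bs \<in> B' - S1"
      then have "hd bs - k = Suc (hd bs - k - 1)" using k_le[of bs] by (auto simp: S1_def)
      then have "?s bs = y 0 \<otimes>\<^bsub>poly_ring n\<^esub> (y 0 ^ (hd bs - k - 1) * ?t bs)"
        by (metis (no_types, lifting) mult.assoc power_Suc poly_ring_simps(2))
      moreover have "y 0 ^ (hd bs - k - 1) * ?t bs \<in> ?C"
        using bs by (intro carrier_mult[OF carrier_power tC] yC) auto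
      ultimately show "?s bs \<in> q 1" using q1.I_r_closed[OF y0(1)] by metis
    qed
    moreover have "sum ?s B' = sum ?s S1 + sum ?s (B' - S1)"
      using sum.subset_diff[of S1 B' ?s] B'(1) by (simp add: S1_def add.commute)
    ultimately have "sum ?s S1 \<in> q 1"
    proof -
      assume a: "sum ?s (B' - S1) \<in> q 1" and e: "sum ?s B' = sum ?s S1 + sum ?s (B' - S1)"
      show ?thesis using ideal_diff[OF q1.is_ideal in1 a] unfolding e by simp
    qed
    also have "sum ?s S1 = sum ?t S1" by (rule sum.cong) (simp_all add: S1_def)
    also have "\<dots> = (\<Sum>bs\<in>tl ` S1. const (c (k # bs)) * power_product ?y bs)"
    proof -
      have cons: "k # tl bs = bs" if "bs \<in> S1" for bs
        using that len[of bs] by (cases bs) (auto simp: S1_def)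
      then have "inj_on tl S1" by (metis inj_onI)
      then show ?thesis using cons by (simp add: sum.reindex)
    qed
    finally have "\<forall>bs\<in>tl ` S1. c (k # bs) = 0"
    proof (intro Suc.IH[of "\<lambda>i. q (Suc i)" ?y "tl ` S1" "\<lambda>bs. c (k # bs)"])
      show "finite (tl ` S1)" using B'(1) by (simp add: S1_def)
      show "length bs = l" if "bs \<in> tl ` S1" for bs using that len by (auto simp: S1_def)
    qed (use Suc.prems(1-3) in auto)
    \<comment> \<open>As the minimum is attained, \<open>S1\<close> is nonempty. The induction
      hypothesis kills a coefficient there that is nonzero by the choice of
      \<open>B'\<close>.\<close>
    moreover have "k \<in> hd ` B'" unfolding k_def using B'(1,2) by (intro Min_in) simp_all
    then obtain bs where bs: "bs \<in> B'" "hd bs = k" by blast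
    then have "bs \<in> S1" "k # tl bs = bs" using len[of bs] by (cases bs; auto simp: S1_def)+
    ultimately have "c bs = 0" by (metis image_eqI)
    then show False using bs(1) by (simp add: B'_def)
  qed
qed

section \<open>Counting monomials in a box\<close>

definition bounded_exponents :: "nat set \<Rightarrow> nat \<Rightarrow> (nat \<Rightarrow>\<^sub>0 nat) set"
  where "bounded_exponents D e = {m. Poly_Mapping.keys m \<subseteq> D \<and> (\<forall>i. Poly_Mapping.lookup m i \<le> e)}"

lemma bounded_exponents_mono: "e \<le> e' \<Longrightarrow> bounded_exponents D e \<subseteq> bounded_exponents D e'"
  by (auto simp: bounded_exponents_def intro: order.trans)

lemma card_bounded_exponents:
  assumes "finite D"
  shows "finite (bounded_exponents D e) \<and> card (bounded_exponents D e) \<le> (e + 1) ^ card D"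
proof -
  let ?f = "\<lambda>m. restrict (Poly_Mapping.lookup m) D"
  have inj: "inj_on ?f (bounded_exponents D e)"
  proof (rule inj_onI)
    fix a b assume a: "a \<in> bounded_exponents D e" and b: "b \<in> bounded_exponents D e" and eq: "?f a = ?f b"
    show "a = b"
    proof (rule poly_mapping_eqI)
      fix i
      show "Poly_Mapping.lookup a i = Poly_Mapping.lookup b i"
      proof (cases "i \<in> D")
        case True
        then show ?thesis using fun_cong[OF eq, of i] by simp
      next
        case False
        then have "i \<notin> Poly_Mapping.keys a" "i \<notin> Poly_Mapping.keys b"
          using a b by (auto simp: bounded_exponents_def)
        then show ?thesis by (simp add: in_keys_iff)
      qed
    qed
  qed
  have sub: "?f ` bounded_exponents D e \<subseteq> D \<rightarrow>\<^sub>E {..e}"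
    by (auto simp: bounded_exponents_def)
  have fin: "finite (D \<rightarrow>\<^sub>E {..e})" using assms by (intro finite_PiE) auto
  have "card (bounded_exponents D e) \<le> card (D \<rightarrow>\<^sub>E {..e})"
    by (rule card_inj_on_le[OF inj sub fin])
  then show ?thesis
    using inj_on_finite[OF inj sub fin] assms by (simp add: card_funcsetE)
qed

text \<open>Coordinatewise bounds add under multiplication, as degree bounds do, while the number of
  exponents in a box is bounded by a plain power.\<close>

lemma mono_span_bounded_mult:
  assumes "p \<in> mono_span (bounded_exponents D e)" "q \<in> mono_span (bounded_exponents D e')"
  shows "p * q \<in> mono_span (bounded_exponents D (e + e'))"
  unfolding mono_span_iff
proof
  fix m assume "m \<in> Poly_Mapping.keys (p * q)"
  then obtain a b where ab: "m = a + b" "a \<in> Poly_Mapping.keys p" "b \<in> Poly_Mapping.keys q"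
    using keys_mult[of p q] by blast
  have "a \<in> bounded_exponents D e" "b \<in> bounded_exponents D e'"
    using ab(2,3) assms by (auto simp: mono_span_iff)
  then show "m \<in> bounded_exponents D (e + e')"
    unfolding ab(1) bounded_exponents_def by (auto simp: keys_plus_nat lookup_add add_mono)
qed

lemma mono_span_bounded_power:
  assumes "p \<in> mono_span (bounded_exponents D e)"
  shows "p ^ j \<in> mono_span (bounded_exponents D (j * e))"
proof (induction j)
  case 0
  show ?case by (simp add: mono_span_iff bounded_exponents_def)
next
  case (Suc j)
  show ?case using mono_span_bounded_mult[OF assms Suc.IH] by simp
qed

text \<open>Each factor \<open>y i ^ b\<close> has coordinates at most \<open>N * e\<close>, and
  there are \<open>length bs\<close> factors. The bound is uniform in \<open>bs\<close>, so one box
  holds all the power products to be counted.\<close>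

lemma power_product_bounded:
  assumes "\<And>i. i < length bs \<Longrightarrow> y i \<in> mono_span (bounded_exponents D e)" "\<And>b. b \<in> set bs \<Longrightarrow> b \<le> N"
  shows "power_product y bs \<in> mono_span (bounded_exponents D (length bs * (N * e)))"
  using assms
proof (induction bs arbitrary: y)
  case Nil
  show ?case by (simp add: mono_span_iff bounded_exponents_def)
next
  case (Cons b bs)
  have "y 0 ^ b \<in> mono_span (bounded_exponents D (b * e))"
    by (rule mono_span_bounded_power) (use Cons.prems in simp)
  moreover have "bounded_exponents D (b * e) \<subseteq> bounded_exponents D (N * e)"
    by (rule bounded_exponents_mono) (use Cons.prems(2) in simp)
  ultimately have "y 0 ^ b \<in> mono_span (bounded_exponents D (N * e))"
    by (auto simp: mono_span_iff)
  moreover have "power_product (\<lambda>i. y (Suc i)) bs \<in> mono_span (bounded_exponents D (length bs * (N * e)))"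
    by (rule Cons.IH) (use Cons.prems in auto)
  ultimately have "y 0 ^ b * power_product (\<lambda>i. y (Suc i)) bs
      \<in> mono_span (bounded_exponents D (N * e + length bs * (N * e)))"
    by (rule mono_span_bounded_mult)
  then show ?case by simp
qed

lemma bounded_exponents_exists:
  fixes y :: "nat \<Rightarrow> ('k::field) mpoly"
  assumes "\<And>i w. i < l \<Longrightarrow> w \<in> Poly_Mapping.keys (y i) \<Longrightarrow> Poly_Mapping.keys w \<subseteq> D"
  shows "\<exists>e. \<forall>i<l. y i \<in> mono_span (bounded_exponents D e)"
proof -
  let ?S = "\<Union>i<l. \<Union>w\<in>Poly_Mapping.keys (y i). Poly_Mapping.lookup w ` Poly_Mapping.keys w"
  have fin: "finite ?S" by simp
  have "Poly_Mapping.lookup w j \<le> Max (insert 0 ?S)" if "i < l" "w \<in> Poly_Mapping.keys (y i)" for i w j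
  proof (cases "j \<in> Poly_Mapping.keys w")
    case True
    then have "Poly_Mapping.lookup w j \<in> ?S" using that by blast
    then show ?thesis using fin by (intro Max_ge) simp_all
  next
    case False
    then show ?thesis by (simp add: in_keys_iff)
  qed
  then have "\<forall>i<l. y i \<in> mono_span (bounded_exponents D (Max (insert 0 ?S)))"
    using assms unfolding mono_span_iff bounded_exponents_def by blast
  then show ?thesis ..
qed

text \<open>Scalars act through constant polynomials. The structure serves to compare the size of an
  independent set with that of a spanning set.\<close>

interpretation mpoly_space: vector_space "\<lambda>c p. const c * (p :: ('k::field) mpoly)"
  by unfold_locales
    (simp_all add: algebra_simps const_def single_add mult_single flip: mult.assoc)

lemma mono_span_subset_span: "(mono_span E :: ('k::field) mpoly set) \<subseteq> mpoly_space.span (monomial ` E)"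
proof
  fix p :: "'k mpoly" assume "p \<in> mono_span E"
  then have p: "Poly_Mapping.keys p \<subseteq> E" by (simp add: mono_span_iff)
  have "(\<Sum>m\<in>Poly_Mapping.keys p. const (Poly_Mapping.lookup p m) * monomial m) \<in> mpoly_space.span (monomial ` E)"
    using p by (intro mpoly_space.span_sum mpoly_space.span_scale mpoly_space.span_base) auto
  also have "(\<Sum>m\<in>Poly_Mapping.keys p. const (Poly_Mapping.lookup p m) * monomial m) = p"
    by (subst (3) poly_mapping_expand[of p]) (simp add: const_def monomial_def mult_single)
  finally show "p \<in> mpoly_space.span (monomial ` E)" .
qed

text \<open>If \<open>l\<close> exceeded \<open>d = card D\<close>, the power products with
  exponents at most \<open>N\<close> would be \<open>(N + 1)^l\<close> independent elements in the
  span of at most \<open>(l * N * e + 1)^d\<close> monomials, which fails for the \<open>N\<close>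
  chosen below.\<close>

lemma prime_chain_length:
  fixes q :: "nat \<Rightarrow> ('k::field) mpoly set"
  assumes prime: "\<And>i. i \<le> l \<Longrightarrow> primeideal (q i) (poly_ring n)"
    and sub: "\<And>i. i < l \<Longrightarrow> q i \<subseteq> q (Suc i)"
    and y: "\<And>i. i < l \<Longrightarrow> y i \<in> q (Suc i) - q i"
    and D: "finite D" "\<And>i w. i < l \<Longrightarrow> w \<in> Poly_Mapping.keys (y i) \<Longrightarrow> Poly_Mapping.keys w \<subseteq> D"
  shows "l \<le> card D"
proof (rule ccontr)
  assume "\<not> l \<le> card D"
  obtain e where e: "\<forall>i<l. y i \<in> mono_span (bounded_exponents D e)"
    using bounded_exponents_exists[of l y D] D(2) by blast
  \<comment> \<open>The constant that remains once \<open>N + 1\<close> is split off from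
    \<open>l * N * e + 1 \<le> (l * e + 1) * (N + 1)\<close> and both sides are raised to the power
    \<open>card D\<close>. Taking it as \<open>N\<close> gives the bound
    \<open>N * (N + 1)^d\<close>, just below \<open>(N + 1)^(d + 1)\<close>.\<close>
  define N where "N = (l * e + 1) ^ card D"
  define L where "L = {bs. set bs \<subseteq> {..N} \<and> length bs = l}"
  have finL: "finite L" unfolding L_def by (rule finite_lists_length_eq) simp
  have ind: "\<forall>bs\<in>B. c bs = 0"
    if "B \<subseteq> L" "(\<Sum>bs\<in>B. const (c bs) * power_product y bs) = 0" for B and c :: "nat list \<Rightarrow> 'k"
  proof (rule prime_chain_independent[where q = q and l = l and y = y, OF prime sub y])
    show "finite B" using finite_subset[OF that(1) finL] .
    show "length bs = l" if "bs \<in> B" for bs using that \<open>B \<subseteq> L\<close> by (auto simp: L_def)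
    have "additive_subgroup (q 0) (poly_ring n)"
      using prime[of 0] by (simp add: primeideal.axioms(1) ideal.axioms(1))
    then show "(\<Sum>bs\<in>B. const (c bs) * power_product y bs) \<in> q 0"
      using additive_subgroup.zero_closed[of "q 0" "poly_ring n"] that(2) by simp
  qed
  \<comment> \<open>Two equal power products would satisfy a relation with coefficients
    \<open>1\<close> and \<open>- 1\<close>. Injectivity ensures that the set of power products
    really has \<open>(N + 1)^l\<close> elements.\<close>
  have inj: "inj_on (power_product y) L"
  proof (rule inj_onI, rule ccontr)
    fix a b assume ab: "a \<in> L" "b \<in> L" "power_product y a = power_product y b" "a \<noteq> b"
    have "\<forall>bs\<in>{a, b}. (if bs = a then 1 else - 1 :: 'k) = 0"
      by (rule ind) (use ab in \<open>simp_all add: const_def single_uminus\<close>)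
    then show False by simp
  qed
  have indep: "mpoly_space.independent (power_product y ` L)"
    unfolding mpoly_space.independent_explicit_finite_subsets
  proof (intro allI impI)
    fix S u assume S: "S \<subseteq> power_product y ` L" "finite S" "(\<Sum>v\<in>S. const (u v) * v) = 0"
    obtain B where B: "B \<subseteq> L" "inj_on (power_product y) B" "S = power_product y ` B"
      using S(1) by (meson subset_image_inj)
    have "\<forall>bs\<in>B. u (power_product y bs) = 0"
      by (rule ind[OF B(1)]) (use S(3) B(2,3) in \<open>simp add: sum.reindex\<close>)
    then show "\<forall>v\<in>S. u v = 0" using B(3) by blast
  qed
  let ?E = "bounded_exponents D (l * (N * e))"
  have fin: "finite ?E" "card ?E \<le> (l * (N * e) + 1) ^ card D"
    using card_bounded_exponents[OF D(1)] by blast+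
  have "power_product y ` L \<subseteq> mono_span ?E"
    using power_product_bounded[of _ y D e N] e by (fastforce simp: L_def)
  then have "power_product y ` L \<subseteq> mpoly_space.span (monomial ` ?E)"
    using mono_span_subset_span by blast
  then have "card (power_product y ` L) \<le> card (monomial ` ?E :: 'k mpoly set)"
    using mpoly_space.independent_span_bound[OF _ indep] fin(1) by blast
  also have "\<dots> \<le> card ?E" using fin(1) by (rule card_image_le)
  also have "card (power_product y ` L) = (N + 1) ^ l"
    using inj card_lists_length_eq[of "{..N}" l] by (simp add: card_image L_def)
  finally have "(N + 1) ^ l \<le> (l * (N * e) + 1) ^ card D" using fin(2) by simp
  also have "\<dots> \<le> ((l * e + 1) * (N + 1)) ^ card D"
    by (intro power_mono) (simp_all add: algebra_simps)
  also have "\<dots> = N * (N + 1) ^ card D" unfolding power_mult_distrib N_def ..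
  also have "\<dots> < (N + 1) ^ (card D + 1)" by simp
  also have "\<dots> \<le> (N + 1) ^ l" by (rule power_increasing) (use \<open>\<not> l \<le> card D\<close> in simp_all)
  finally show False by simp
qed

text \<open>A chain in the quotient is pulled back to primes containing \<open>P\<close>. The
  elements separating consecutive primes can be reduced modulo \<open>P\<close> to involve only
  variables outside \<open>A\<close>, so the chain is no longer than the number of those
  variables.\<close>

lemma krull_dim_vars_le:
  assumes "A \<subseteq> {1..n}"
  shows "krull_dim (poly_ring n Quot (mono_span (var_exponents n A) :: ('k::field) mpoly set))
    \<le> enat (card ({1..n} - A))"
  unfolding krull_dim_def
proof (rule Sup_least, clarify)
  let ?R = "poly_ring n :: 'k mpoly ring" and ?V = "var_exponents n A"
  let ?P = "mono_span ?V :: 'k mpoly set"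
  fix l and p :: "nat \<Rightarrow> 'k mpoly set set"
  assume prime: "\<forall>i\<le>l. primeideal (p i) (?R Quot ?P)" and strict: "\<forall>i<l. p i \<subset> p (Suc i)"
  note P_ideal = ideal_mono_span[OF upset_var_exponents, of n A, where 'k = 'k]
  define q where "q i = {x \<in> carrier ?R. ?P +>\<^bsub>?R\<^esub> x \<in> p i}" for i
  have q_prime: "primeideal (q i) ?R" if "i \<le> l" for i
    unfolding q_def using prime that by (intro primeideal_quot_vimage[OF cring_poly_ring P_ideal]) simp
  have P_q: "?P \<subseteq> q i" if "i \<le> l" for i
  proof
    fix x assume x: "x \<in> ?P"
    interpret p: primeideal "p i" "?R Quot ?P" using prime that by simp
    have "?P +>\<^bsub>?R\<^esub> x = ?P" using coset_eq_iff[of n ?V x 0] coset_zero[of n ?V] x by simp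
    also have "\<dots> \<in> p i" using additive_subgroup.zero_closed[OF p.additive_subgroup_axioms] by (simp add: FactRing_def)
    finally show "x \<in> q i" using x by (auto simp: q_def mono_span_iff var_exponents_def)
  qed
  have q_sub: "q i \<subseteq> q (Suc i)" if "i < l" for i
    using strict that by (auto simp: q_def)
  have "\<exists>y. y \<in> q (Suc i) - q i \<and> Poly_Mapping.keys y \<inter> ?V = {}" if i: "i < l" for i
  proof -
    obtain C where C: "C \<in> p (Suc i)" "C \<notin> p i" using strict i by blast
    interpret p: primeideal "p (Suc i)" "?R Quot ?P" using prime i by simp
    interpret q: primeideal "q i" ?R using q_prime i by simp
    interpret q': primeideal "q (Suc i)" ?R using q_prime i by simp
    obtain x where x: "x \<in> carrier ?R" "C = ?P +>\<^bsub>?R\<^esub> x"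
      using p.Icarr[OF C(1)] unfolding carrier_quot by blast
    have x': "x \<in> q (Suc i)" "x \<notin> q i" using C x by (simp_all add: q_def)
    \<comment> \<open>The part \<open>r\<close> lies in \<open>?P\<close>, hence in both primes, so
      removing it changes neither membership.\<close>
    obtain y r where yr: "x = y + r" "Poly_Mapping.keys y \<subseteq> Poly_Mapping.keys x - ?V"
      "Poly_Mapping.keys r \<subseteq> Poly_Mapping.keys x \<inter> ?V" by (rule poly_mapping_split)
    have r: "r \<in> ?P" using yr(3) by (simp add: mono_span_iff)
    then have rq: "r \<in> q i" "r \<in> q (Suc i)" using P_q[of i] P_q[of "Suc i"] i by auto
    have "y \<in> q (Suc i)" using ideal_diff[OF q'.is_ideal x'(1) rq(2)] by (simp add: yr(1))
    moreover have "y \<notin> q i" using ideal_add[OF q.is_ideal _ rq(1), of y] x'(2) by (auto simp: yr(1))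
    ultimately show ?thesis using yr(2) by blast
  qed
  then have "\<forall>i\<in>{..<l}. \<exists>y. y \<in> q (Suc i) - q i \<and> Poly_Mapping.keys y \<inter> ?V = {}" by simp
  then obtain y where y: "\<forall>i\<in>{..<l}. y i \<in> q (Suc i) - q i \<and> Poly_Mapping.keys (y i) \<inter> ?V = {}"
    by (rule bchoice[THEN exE])
  have "Poly_Mapping.keys w \<subseteq> {1..n} - A" if "i < l" "w \<in> Poly_Mapping.keys (y i)" for i w
  proof -
    have "y i \<in> carrier ?R" "w \<notin> ?V" using y that by (auto simp: q_def)
    then have "w \<in> exponents n" "w \<notin> ?V" using that(2) by auto
    then show ?thesis by (auto simp: exponents_def var_exponents_def)
  qed
  then show "enat l \<le> enat (card ({1..n} - A))"
    using prime_chain_length[where q = q and l = l and y = y and D = "{1..n} - A", OF q_prime q_sub] y by simp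
qed

section \<open>Comparison of the filtrations\<close>

text \<open>True at the extremes as well, because \<open>0 - 1 = 0\<close> and \<infinity> stays
  \<infinity> when \<open>1\<close> is subtracted.\<close>

lemma enat_diff_one_le_iff: "(a :: enat) - 1 \<le> b \<longleftrightarrow> a \<le> b + 1"
  by (cases a; cases b) (auto simp: one_enat_def)

text \<open>Each surviving step keeps its set of variables, now read in one variable less. Its
  dimension falls by exactly one, and it is compared with the original step through
  \<open>g\<close>.\<close>

lemma prime_filtration_specialize:
  fixes I :: "('k::field) mpoly set"
  assumes hom: "\<phi> \<in> algebra_hom (Suc k) k" "\<forall>i\<in>{1..k}. \<phi> (X i) = X i" "\<phi> (X (Suc k)) = 1"
    and filt: "prime_filtration (Suc k) I r F P"
  shows "\<exists>s H Q. prime_filtration k (\<phi> ` I) s H Q \<and>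
    fdepth_filtration (Suc k) r P - 1 \<le> fdepth_filtration k s Q"
proof -
  obtain E A where E: "\<forall>j\<le>r. upset (Suc k) (E j) \<and> F j = mono_span (E j)" "E r = exponents (Suc k)"
    and A: "\<forall>j\<in>{1..r}. A j \<subseteq> {1..Suc k} \<and> P j = mono_span (var_exponents (Suc k) (A j)) \<and>
      (\<exists>m. prime_step (Suc k) (E (j - 1)) (E j) m (A j))"
    by (rule prime_filtration_exponents[OF filt])
  define G where "G j = drop_var (Suc k) ` E j" for j
  \<comment> \<open>Recording \<open>Suc k \<notin> A j\<close> for surviving steps places their
    variable sets inside \<open>{1..k}\<close> and later fixes the change of dimension.\<close>
  define R where "R j D D' \<longleftrightarrow> Suc k \<notin> A j \<and> (\<exists>m. prime_step k D D' m (A j))" for j D D'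
  have "G (j - 1) = G j \<or> R j (G (j - 1)) (G j)" if j: "j \<in> {1..r}" for j
  proof -
    have "j - 1 \<le> r" using j by auto
    then have up: "upset (Suc k) (E (j - 1))" using E(1) by blast
    obtain m where "prime_step (Suc k) (E (j - 1)) (E j) m (A j)" using A j by blast
    then show ?thesis
      using prime_step_drop_var_trivial[OF up] prime_step_drop_var[OF up]
      unfolding G_def R_def by metis
  qed
  then obtain s :: nat and g H where H: "H 0 = G 0" "H s = G r" "\<forall>j\<le>s. H j \<in> G ` {..r}"
    and g: "\<forall>j\<in>{1..s}. g j \<in> {1..r} \<and> R (g j) (H (j - 1)) (H j)"
    using chain_remove_repetitions[of r G R] by blast
  have up: "\<forall>j\<le>s. upset k (H j)"
  proof (intro allI impI)
    fix j assume "j \<le> s"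
    then obtain i where "i \<le> r" "H j = G i" using H(3) by auto
    then show "upset k (H j)" using upset_drop_var E(1) by (simp add: G_def)
  qed
  have Ag: "A (g j) \<subseteq> {1..k}" if "j \<in> {1..s}" for j
  proof -
    have "A (g j) \<subseteq> {1..Suc k}" "Suc k \<notin> A (g j)" using A g that by (auto simp: R_def)
    then show ?thesis by (auto simp: le_Suc_eq)
  qed
  have "I = mono_span (E 0)" using filt E(1) by (simp add: prime_filtration_def)
  then have I: "\<phi> ` I = mono_span (H 0)"
    using specialize_mono_span[OF hom, of "E 0"] E(1) unfolding H(1) G_def upset_def by simp
  let ?Q = "\<lambda>j. mono_span (var_exponents k (A (g j))) :: 'k mpoly set"
  have "prime_filtration k (\<phi> ` I) s (\<lambda>j. mono_span (H j)) ?Q"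
    unfolding I
  proof (rule prime_filtration_mono_span[OF up])
    show "H s = exponents k" unfolding H(2) G_def E(2) by (rule drop_var_exponents)
    show "\<forall>j\<in>{1..s}. A (g j) \<subseteq> {1..k} \<and> (\<exists>m. prime_step k (H (j - 1)) (H j) m (A (g j)))"
      using g Ag by (simp add: R_def)
  qed
  moreover have "fdepth_filtration (Suc k) r P - 1 \<le> krull_dim (poly_ring k Quot ?Q j)"
    if j: "j \<in> {1..s}" for j
  proof -
    have gj: "g j \<in> {1..r}" "Suc k \<notin> A (g j)" using g j by (auto simp: R_def)
    \<comment> \<open>The last variable is free in the original quotient and is the only free
      variable that is lost.\<close>
    have "{1..Suc k} - A (g j) = insert (Suc k) ({1..k} - A (g j))" using gj(2) by auto
    then have card: "card ({1..Suc k} - A (g j)) = card ({1..k} - A (g j)) + 1" by simp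
    have "fdepth_filtration (Suc k) r P \<le> krull_dim (poly_ring (Suc k) Quot P (g j))"
      unfolding fdepth_filtration_def using gj(1) by (rule INF_lower)
    also have "\<dots> \<le> enat (card ({1..k} - A (g j)) + 1)"
      using krull_dim_vars_le[of "A (g j)" "Suc k", where 'k = 'k] A gj(1) card by simp
    also have "\<dots> = enat (card ({1..k} - A (g j))) + 1" by (simp add: one_enat_def)
    also have "\<dots> \<le> krull_dim (poly_ring k Quot ?Q j) + 1"
      by (intro add_right_mono krull_dim_vars_ge Ag j)
    finally show ?thesis unfolding enat_diff_one_le_iff .
  qed
  \<comment> \<open>If no step survives, then \<open>s = 0\<close>, the image is the whole ring, and
    the infimum over the empty set is \<infinity>.\<close>
  then have "fdepth_filtration (Suc k) r P - 1 \<le> fdepth_filtration k s ?Q"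
    unfolding fdepth_filtration_def[of k] by (rule INF_greatest)
  ultimately show ?thesis by blast
qed

theorem corollary2p3:
  fixes n :: nat
    and \<phi> :: "('k::field) mpoly \<Rightarrow> 'k mpoly"
    and I :: "'k mpoly set"
  assumes "n \<ge> 1"
    and "\<phi> \<in> algebra_hom n (n - 1)"
    and "\<forall>i \<in> {1..n - 1}. \<phi> (X i) = X i"
    and "\<phi> (X n) = 1"
    and "monomial_ideal n I"
    and "pretty_clean n I"
  shows "fdepth (n - 1) (\<phi> ` I) \<ge> fdepth n I - 1"
proof -
  obtain k where n: "n = Suc k" using assms(1) by (cases n) auto
  have hom: "\<phi> \<in> algebra_hom (Suc k) k" "\<forall>i\<in>{1..k}. \<phi> (X i) = X i" "\<phi> (X (Suc k)) = 1"
    using assms(2-4) by (simp_all add: n)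
  \<comment> \<open>With the \<open>1\<close> moved to the right, the bound no longer depends on the
    filtration and passes to the supremum.\<close>
  have "fdepth_filtration (Suc k) r P \<le> fdepth k (\<phi> ` I) + 1"
    if filt: "prime_filtration (Suc k) I r F P" for r F P
  proof -
    obtain s H Q where "prime_filtration k (\<phi> ` I) s H Q"
      and le: "fdepth_filtration (Suc k) r P - 1 \<le> fdepth_filtration k s Q"
      using prime_filtration_specialize[OF hom filt] by blast
    then have "fdepth_filtration k s Q \<le> fdepth k (\<phi> ` I)"
      unfolding fdepth_def by (intro Sup_upper) blast
    with le show ?thesis unfolding enat_diff_one_le_iff[symmetric] by (rule order.trans)
  qed
  then have "fdepth (Suc k) I \<le> fdepth k (\<phi> ` I) + 1"
    unfolding fdepth_def[of "Suc k"] by (intro Sup_least) blast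
  then show ?thesis by (simp add: n enat_diff_one_le_iff)
qed

end
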